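(* Let $0<\beta<1$ and let $p=p(N)$ satisfy $p^3N^2\to 0$ as $N\to\infty$. Then, as $N\to\infty$, $$Np^{3/2}\left(\log Z_N(\beta)-N\log 2-N^2p\,\log\cosh\left(\frac{\beta}{2Np}\right)\right)\to\mathcal{N}\left(0,\frac{\beta^4}{64}\right)$$ in distribution.
   Context: Ising model on a directed Erdős–Rényi graph: for each $N\in\mathbb{N}$ let $p=p(N)\in(0,1]$ and let $(\varepsilon_{i,j})_{i,j=1}^N$ be independent Bernoulli random variables (diagonal $i=j$ included, and $\varepsilon_{i,j}$, $\varepsilon_{j,i}$ are independent for $i\ne j$) with $\mathbb{P}(\varepsilon_{i,j}=1)=p=1-\mathbb{P}(\varepsilon_{i,j}=0)$. For $\sigma\in\{-1,+1\}^N$ put $H(\sigma)=-\frac{1}{2Np}\sum_{i,j=1}^N\sigma_i\sigma_j\varepsilon_{i,j}$, and for $\beta>0$ let $Z_N(\beta)=\sum_{\sigma\in\{-1,+1\}^N}\exp(-\beta H(\sigma))$ (a random variable). $\mathcal{N}(0,v)$ denotes the centered normal distribution with variance $v$.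
   Formalization: The additional assumption Np → ∞ is made; without it the claim is false (for p = N^{-3} there are no edges with probability tending to 1 and the limit is the point mass at 0). *)

theory Defs
  imports "HOL-Probability.Probability"
begin

definition spin_configs :: "nat \<Rightarrow> (nat \<Rightarrow> real) set" where
  "spin_configs N = {1..N} \<rightarrow>\<^sub>E {-1, 1}"

definition hamiltonian :: "nat \<Rightarrow> real \<Rightarrow> (nat \<Rightarrow> nat \<Rightarrow> real) \<Rightarrow> (nat \<Rightarrow> real) \<Rightarrow> real" where
  "hamiltonian N p e \<sigma> =
     - (1 / (2 * real N * p)) * (\<Sum>i=1..N. \<Sum>j=1..N. \<sigma> i * \<sigma> j * e i j)"

definition partition_fun :: "nat \<Rightarrow> real \<Rightarrow> (nat \<Rightarrow> nat \<Rightarrow> real) \<Rightarrow> real \<Rightarrow> real" where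
  "partition_fun N p e \<beta> = (\<Sum>\<sigma>\<in>spin_configs N. exp (- \<beta> * hamiltonian N p e \<sigma>))"

text \<open>The adjacency variables of a directed graph on \<open>{1..N}\<close>: all ordered pairs are
  independent of each other, and loops are allowed.\<close>

definition directed_erdos_renyi ::
    "'a measure \<Rightarrow> nat \<Rightarrow> real \<Rightarrow> (nat \<Rightarrow> nat \<Rightarrow> 'a \<Rightarrow> real) \<Rightarrow> bool" where
  "directed_erdos_renyi M N p \<epsilon> \<longleftrightarrow>
     prob_space M \<and>
     prob_space.indep_vars M (\<lambda>_. borel) (\<lambda>(i, j). \<epsilon> i j) ({1..N} \<times> {1..N}) \<and>
     (\<forall>i\<in>{1..N}. \<forall>j\<in>{1..N}.
        measure M {\<omega> \<in> space M. \<epsilon> i j \<omega> = 1} = p \<and>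
        measure M {\<omega> \<in> space M. \<epsilon> i j \<omega> = 0} = 1 - p)"

end

theory Submission
  imports Defs "HOL-Real_Asymp.Real_Asymp"
begin

text \<open>Put \<open>g = \<beta> / (2 N p)\<close>. Because \<open>exp (s y) = cosh y (1 + s tanh y)\<close> for \<open>s = \<plusminus>1\<close>, the centred free
  energy splits into \<open>\<Sum>\<^sub>i\<^sub>j (ln (cosh (g \<epsilon>\<^sub>i\<^sub>j)) - p ln (cosh g)) + ln W\<close>, where \<open>W\<close> is the average over
  all spin configurations of \<open>\<Prod>\<^sub>i\<^sub>j (1 + \<sigma>\<^sub>i \<sigma>\<^sub>j tanh (g \<epsilon>\<^sub>i\<^sub>j))\<close>. The first part is a sum of \<open>N\<^sup>2\<close> i.i.d. terms
  whose rescaled characteristic function converges to the Gaussian one. For the second part, the mean of \<open>W\<close>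
  is bounded away from \<open>0\<close> and \<open>\<infinity>\<close>, and comparing two replicas bounds the variance of \<open>W\<close> by
  a constant over \<open>N p\<close>; both use that \<open>exp (\<theta> (\<Sum>\<^sub>i \<sigma>\<^sub>i)\<^sup>2 / (2 N))\<close> has bounded spin average for \<open>\<theta> < 1\<close>.
  Hence \<open>ln W\<close> is bounded in probability and is killed by the prefactor \<open>N p\<^sup>3\<^sup>/\<^sup>2 \<rightarrow> 0\<close>.\<close>

section \<open>Exponential moments of the overlap\<close>

lemma tanh_le_self:
  fixes x :: real
  assumes "0 \<le> x"
  shows "tanh x \<le> x"
proof -
  have "(\<lambda>x. x - tanh x) 0 \<le> (\<lambda>x. x - tanh x) x"
    using assms
  proof (rule DERIV_nonneg_imp_nondecreasing)
    fix y :: real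
    have "((\<lambda>x. x - tanh x) has_real_derivative (tanh y)\<^sup>2) (at y)"
      using cosh_real_pos[of y] by (auto intro!: derivative_eq_intros)
    then show "\<exists>z. ((\<lambda>x. x - tanh x) has_real_derivative z) (at y) \<and> 0 \<le> z"
      using zero_le_power2 by blast
  qed
  then show ?thesis by simp
qed

text \<open>\<open>ln (cosh x)\<close> vanishes at 0 and has derivative \<open>tanh x\<close>, which
  is at most \<open>x\<close> for nonnegative \<open>x\<close>; evenness settles negative
  \<open>x\<close>.\<close>

lemma cosh_le_exp_half_square:
  fixes x :: real
  shows "cosh x \<le> exp (x\<^sup>2 / 2)"
proof -
  have *: "ln (cosh y) \<le> y\<^sup>2 / 2" if "0 \<le> y" for y :: real
  proof -
    have "(\<lambda>x. x\<^sup>2 / 2 - ln (cosh x)) 0 \<le> (\<lambda>x. x\<^sup>2 / 2 - ln (cosh x)) y"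
      using that
    proof (rule DERIV_nonneg_imp_nondecreasing)
      fix z :: real
      assume "0 \<le> z"
      have "((\<lambda>x. x\<^sup>2 / 2 - ln (cosh x)) has_real_derivative (z - tanh z)) (at z)"
        using cosh_real_pos[of z]
        by (auto intro!: derivative_eq_intros simp: tanh_def field_simps)
      moreover have "0 \<le> z - tanh z"
        using tanh_le_self[OF \<open>0 \<le> z\<close>] by simp
      ultimately show "\<exists>w. ((\<lambda>x. x\<^sup>2 / 2 - ln (cosh x)) has_real_derivative w) (at z) \<and> 0 \<le> w"
        by blast
    qed
    then show ?thesis by simp
  qed
  have "ln (cosh x) \<le> x\<^sup>2 / 2"
    using *[of "\<bar>x\<bar>"] by (cases "0 \<le> x") simp_all
  then show ?thesis
    using cosh_real_pos[of x] by (metis exp_le_cancel_iff exp_ln)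
qed

lemma finite_spin_configs [simp]: "finite (spin_configs N)"
  unfolding spin_configs_def by (intro finite_PiE) auto

lemma spin_configsD: "\<sigma> \<in> spin_configs N \<Longrightarrow> i \<in> {1..N} \<Longrightarrow> \<sigma> i \<in> {-1, 1}"
  unfolding spin_configs_def by (auto simp: PiE_iff)

lemma card_spin_configs: "card (spin_configs N) = 2 ^ N"
  unfolding spin_configs_def by (simp add: card_PiE numeral_2_eq_2)

text \<open>The exponential factorises over sites. Since \<open>\<tau> i\<close> is a sign, it only
  permutes the two terms at site \<open>i\<close>, so every site contributes
  \<open>2 * cosh s\<close>, whatever \<open>\<tau>\<close> is.\<close>

lemma sum_spin_configs_exp_overlap:
  fixes s :: real
  assumes \<tau>: "\<And>i. i \<in> {1..N} \<Longrightarrow> \<tau> i \<in> {-1, 1}"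
  shows "(\<Sum>\<sigma>\<in>spin_configs N. exp (s * (\<Sum>i=1..N. \<sigma> i * \<tau> i))) = (2 * cosh s) ^ N"
proof -
  have "(\<Sum>\<sigma>\<in>spin_configs N. exp (s * (\<Sum>i=1..N. \<sigma> i * \<tau> i)))
      = (\<Sum>\<sigma>\<in>{1..N} \<rightarrow>\<^sub>E {-1, 1}. \<Prod>i=1..N. exp (s * (\<sigma> i * \<tau> i)))"
    unfolding spin_configs_def by (simp add: sum_distrib_left exp_sum)
  also have "\<dots> = (\<Prod>i=1..N. \<Sum>a\<in>{-1, 1}. exp (s * (a * \<tau> i)))"
    by (rule prod_sum_PiE[symmetric]) auto
  also have "\<dots> = (\<Prod>i=1..N. 2 * cosh s)"
    using \<tau> by (intro prod.cong) (fastforce simp: cosh_field_def)+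
  finally show ?thesis by simp
qed

text \<open>Completing the square turns the integrand into \<open>exp (a\<^sup>2 / 2)\<close> times
  the normal density with mean \<open>a\<close>.\<close>

lemma has_bochner_integral_std_normal_exp:
  fixes a :: real
  shows "has_bochner_integral lborel (\<lambda>x. std_normal_density x * exp (a * x)) (exp (a\<^sup>2 / 2))"
proof -
  have "has_bochner_integral lborel (\<lambda>x. exp (a\<^sup>2 / 2) * normal_density a 1 x) (exp (a\<^sup>2 / 2) * 1)"
    using integrable_normal_density[of 1 a] integral_normal_density[of 1 a]
    by (intro has_bochner_integral_mult_right) (auto simp: has_bochner_integral_iff)
  moreover have "exp (a\<^sup>2 / 2) * normal_density a 1 x = std_normal_density x * exp (a * x)" for x
    by (simp add: normal_density_def mult_exp_exp field_simps power2_eq_square)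
  ultimately show ?thesis by simp
qed

text \<open>The integrand is a multiple of the centred normal density of variance
  \<open>1 / (1 - \<theta>)\<close>; this is where \<open>\<theta> < 1\<close>, and in the end
  \<open>\<beta> < 1\<close>, is essential.\<close>

lemma has_bochner_integral_std_normal_exp_square:
  fixes \<theta> :: real
  assumes "\<theta> < 1"
  shows "has_bochner_integral lborel (\<lambda>x. std_normal_density x * exp (\<theta> * x\<^sup>2 / 2)) (1 / sqrt (1 - \<theta>))"
proof -
  let ?s = "1 / sqrt (1 - \<theta>)"
  have s: "0 < ?s" using assms by simp
  have "has_bochner_integral lborel (\<lambda>x. ?s * normal_density 0 ?s x) (?s * 1)"
    using integrable_normal_density[OF s, of 0] integral_normal_density[OF s, of 0]
    by (intro has_bochner_integral_mult_right) (auto simp: has_bochner_integral_iff)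
  moreover have "?s * normal_density 0 ?s x = std_normal_density x * exp (\<theta> * x\<^sup>2 / 2)" for x
    using assms
    by (simp add: normal_density_def mult_exp_exp real_sqrt_divide divide_simps)
       (simp add: algebra_simps)
  ultimately show ?thesis by simp
qed

text \<open>Hubbard-Stratonovich: the square in the exponent is linearised by a Gaussian integral.\<close>

lemma sum_spin_configs_exp_square_overlap_le:
  fixes \<theta> :: real
  assumes \<theta>: "0 \<le> \<theta>" "\<theta> < 1" and "N \<ge> 1"
    and \<tau>: "\<And>i. i \<in> {1..N} \<Longrightarrow> \<tau> i \<in> {-1, 1}"
  shows "(\<Sum>\<sigma>\<in>spin_configs N. exp (\<theta> / (2 * real N) * (\<Sum>i=1..N. \<sigma> i * \<tau> i)\<^sup>2)) \<le> 2 ^ N / sqrt (1 - \<theta>)"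
    (is "?S \<le> _")
proof -
  define m where "m \<sigma> = (\<Sum>i=1..N. \<sigma> i * \<tau> i)" for \<sigma> :: "nat \<Rightarrow> real"
  \<comment> \<open>Chosen so that \<open>(s * m \<sigma>)\<^sup>2 / 2\<close> is exactly the
    exponent in the sum, that is, the logarithm of a Gaussian moment generating function at
    \<open>s * m \<sigma>\<close>.\<close>
  define s where "s = sqrt (\<theta> / N)"
  have s2: "s\<^sup>2 = \<theta> / N" using \<theta> by (simp add: s_def)
  have *: "has_bochner_integral lborel
      (\<lambda>x. \<Sum>\<sigma>\<in>spin_configs N. std_normal_density x * exp (s * m \<sigma> * x))
      (\<Sum>\<sigma>\<in>spin_configs N. exp ((s * m \<sigma>)\<^sup>2 / 2))"
    by (intro has_bochner_integral_sum has_bochner_integral_std_normal_exp)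
  have eq: "(\<Sum>\<sigma>\<in>spin_configs N. std_normal_density x * exp (s * m \<sigma> * x))
      = std_normal_density x * (2 * cosh (s * x)) ^ N" for x
    using sum_spin_configs_exp_overlap[of N \<tau> "s * x"] \<tau>
    by (simp add: sum_distrib_left[symmetric] m_def mult_ac)
  have **: "has_bochner_integral lborel
      (\<lambda>x. 2 ^ N * (std_normal_density x * exp (\<theta> * x\<^sup>2 / 2))) (2 ^ N * (1 / sqrt (1 - \<theta>)))"
    by (intro has_bochner_integral_mult_right has_bochner_integral_std_normal_exp_square \<theta>)
  have "?S = (\<Sum>\<sigma>\<in>spin_configs N. exp ((s * m \<sigma>)\<^sup>2 / 2))"
    by (simp add: m_def power_mult_distrib s2 mult.commute)
  also have "\<dots> = (LBINT x. \<Sum>\<sigma>\<in>spin_configs N. std_normal_density x * exp (s * m \<sigma> * x))"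
    using * by (simp add: has_bochner_integral_iff)
  \<comment> \<open>After summing over spins, the integrand contains
    \<open>cosh (s * x) ^ N\<close>. The \<open>N\<close>-th power cancels the \<open>1 / N\<close>
    in \<open>s\<^sup>2\<close>, so the Gaussian bound for \<open>cosh\<close> does not depend on
    \<open>N\<close>.\<close>
  also have "\<dots> \<le> (LBINT x. 2 ^ N * (std_normal_density x * exp (\<theta> * x\<^sup>2 / 2)))"
  proof (rule integral_mono)
    show "integrable lborel (\<lambda>x. \<Sum>\<sigma>\<in>spin_configs N. std_normal_density x * exp (s * m \<sigma> * x))"
      using * by (simp add: has_bochner_integral_iff)
    show "integrable lborel (\<lambda>x. 2 ^ N * (std_normal_density x * exp (\<theta> * x\<^sup>2 / 2)))"
      using ** by (simp only: has_bochner_integral_iff)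
    fix x :: real
    have "cosh (s * x) ^ N \<le> exp ((s * x)\<^sup>2 / 2) ^ N"
      by (intro power_mono cosh_le_exp_half_square cosh_real_nonneg)
    also have "\<dots> = exp (\<theta> * x\<^sup>2 / 2)"
      using \<open>N \<ge> 1\<close> by (simp add: exp_of_nat_mult[symmetric] power_mult_distrib s2)
    finally have "(2 * cosh (s * x)) ^ N \<le> 2 ^ N * exp (\<theta> * x\<^sup>2 / 2)"
      by (simp add: power_mult_distrib)
    then show "(\<Sum>\<sigma>\<in>spin_configs N. std_normal_density x * exp (s * m \<sigma> * x))
        \<le> 2 ^ N * (std_normal_density x * exp (\<theta> * x\<^sup>2 / 2))"
      unfolding eq using mult_left_mono[of _ _ "std_normal_density x"]
      by (fastforce simp: mult.left_commute)
  qed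
  also have "\<dots> = 2 ^ N * (1 / sqrt (1 - \<theta>))"
    using ** by (simp only: has_bochner_integral_iff)
  finally show ?thesis by simp
qed

section \<open>Replica bounds\<close>

definition spin_avg :: "nat \<Rightarrow> ((nat \<Rightarrow> real) \<Rightarrow> real) \<Rightarrow> real" where
  "spin_avg N f = (\<Sum>\<sigma>\<in>spin_configs N. f \<sigma>) / 2 ^ N"

text \<open>With \<open>x = p tanh (\<beta> / (2 N p))\<close>, \<open>tilt\<close> is the mean over the graph of the weight of a
  configuration, and \<open>tilt2\<close> below is the mean of the product of the weights of two.\<close>

definition tilt :: "nat \<Rightarrow> real \<Rightarrow> (nat \<Rightarrow> real) \<Rightarrow> real" where
  "tilt N x \<sigma> = (\<Prod>(i, j)\<in>{1..N} \<times> {1..N}. 1 + x * (\<sigma> i * \<sigma> j))"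

lemma spin_avg_mono:
  "(\<And>\<sigma>. \<sigma> \<in> spin_configs N \<Longrightarrow> f \<sigma> \<le> g \<sigma>) \<Longrightarrow> spin_avg N f \<le> spin_avg N g"
  unfolding spin_avg_def by (intro divide_right_mono sum_mono) auto

lemma spin_avg_add: "spin_avg N (\<lambda>\<sigma>. f \<sigma> + g \<sigma>) = spin_avg N f + spin_avg N g"
  unfolding spin_avg_def by (simp add: sum.distrib add_divide_distrib)

lemma spin_avg_diff: "spin_avg N (\<lambda>\<sigma>. f \<sigma> - g \<sigma>) = spin_avg N f - spin_avg N g"
  unfolding spin_avg_def by (simp add: sum_subtractf diff_divide_distrib)

lemma spin_avg_cmult: "spin_avg N (\<lambda>\<sigma>. c * f \<sigma>) = c * spin_avg N f"
  unfolding spin_avg_def by (simp add: sum_distrib_left)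

lemma spin_avg_multc: "spin_avg N (\<lambda>\<sigma>. f \<sigma> * c) = spin_avg N f * c"
  unfolding spin_avg_def by (simp add: sum_distrib_right)

lemma spin_avg_const: "spin_avg N (\<lambda>\<sigma>. c) = c"
  unfolding spin_avg_def by (simp add: card_spin_configs)

lemma spin_avg_exp_square_overlap_le:
  assumes "0 \<le> \<theta>" "\<theta> < 1" "N \<ge> 1" "\<And>i. i \<in> {1..N} \<Longrightarrow> \<tau> i \<in> {-1, 1}"
  shows "spin_avg N (\<lambda>\<sigma>. exp (\<theta> / (2 * real N) * (\<Sum>i=1..N. \<sigma> i * \<tau> i)\<^sup>2)) \<le> 1 / sqrt (1 - \<theta>)"
  using sum_spin_configs_exp_square_overlap_le[OF assms]
  unfolding spin_avg_def by (simp add: divide_le_eq)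

lemma spin_avg_exp_square_magnetization_le:
  assumes "0 \<le> \<theta>" "\<theta> < 1" "N \<ge> 1"
  shows "spin_avg N (\<lambda>\<sigma>. exp (\<theta> / (2 * real N) * (\<Sum>i=1..N. \<sigma> i)\<^sup>2)) \<le> 1 / sqrt (1 - \<theta>)"
  using spin_avg_exp_square_overlap_le[OF assms, of "\<lambda>_. 1"] by simp

lemma sum_pairs_product:
  fixes f :: "nat \<Rightarrow> real"
  shows "(\<Sum>(i, j)\<in>{1..N} \<times> {1..N}. f i * f j) = (\<Sum>i=1..N. f i)\<^sup>2"
  by (simp add: power2_eq_square sum_product sum.cartesian_product)

lemma spin_pair_product:
  assumes "\<sigma> \<in> spin_configs N" "i \<in> {1..N}" "j \<in> {1..N}"
  shows "\<sigma> i * \<sigma> j \<in> {-1, 1}"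
  using spin_configsD[OF assms(1,2)] spin_configsD[OF assms(1,3)] by auto

lemma tilt_pos:
  assumes "\<sigma> \<in> spin_configs N" "0 \<le> x" "x < 1"
  shows "0 < tilt N x \<sigma>"
  unfolding tilt_def
proof (intro prod_pos, clarify)
  fix i j assume "i \<in> {1..N}" "j \<in> {1..N}"
  from spin_pair_product[OF assms(1) this] show "0 < 1 + x * (\<sigma> i * \<sigma> j)"
    using assms by auto
qed

text \<open>\<open>1 + y \<le> exp y\<close> in every factor; the exponents sum to the squared
  magnetisation. Taking the product of the inequalities needs nonnegative factors, hence
  \<open>x < 1\<close>.\<close>

lemma tilt_le:
  assumes "\<sigma> \<in> spin_configs N" "0 \<le> x" "x < 1"
  shows "tilt N x \<sigma> \<le> exp (x * (\<Sum>i=1..N. \<sigma> i)\<^sup>2)"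
proof -
  have "tilt N x \<sigma> \<le> (\<Prod>(i, j)\<in>{1..N} \<times> {1..N}. exp (x * (\<sigma> i * \<sigma> j)))"
    unfolding tilt_def
  proof (intro prod_mono, clarify)
    fix i j assume "i \<in> {1..N}" "j \<in> {1..N}"
    from spin_pair_product[OF assms(1) this]
    show "0 \<le> 1 + x * (\<sigma> i * \<sigma> j) \<and> 1 + x * (\<sigma> i * \<sigma> j) \<le> exp (x * (\<sigma> i * \<sigma> j))"
      using assms exp_ge_add_one_self[of "x * (\<sigma> i * \<sigma> j)"] by auto
  qed
  also have "\<dots> = exp (\<Sum>(i, j)\<in>{1..N} \<times> {1..N}. x * (\<sigma> i * \<sigma> j))"
    by (subst exp_sum) (auto intro!: prod.cong)
  also have "(\<Sum>(i, j)\<in>{1..N} \<times> {1..N}. x * (\<sigma> i * \<sigma> j)) = x * (\<Sum>i=1..N. \<sigma> i)\<^sup>2"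
    unfolding sum_pairs_product[symmetric] by (simp add: sum_distrib_left case_prod_unfold)
  finally show ?thesis .
qed

lemma tilt_ge:
  assumes "\<sigma> \<in> spin_configs N" "0 \<le> x" "x \<le> 1/2"
  shows "exp (- 2 * x\<^sup>2 * (real N)\<^sup>2) \<le> tilt N x \<sigma>"
proof -
  have "exp (- 2 * x\<^sup>2 * (real N)\<^sup>2) \<le> exp (x * (\<Sum>i=1..N. \<sigma> i)\<^sup>2 - 2 * x\<^sup>2 * (real N)\<^sup>2)"
    using assms by simp
  also have "x * (\<Sum>i=1..N. \<sigma> i)\<^sup>2 - 2 * x\<^sup>2 * (real N)\<^sup>2
      = (\<Sum>(i, j)\<in>{1..N} \<times> {1..N}. x * (\<sigma> i * \<sigma> j) - 2 * x\<^sup>2)"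
    unfolding sum_pairs_product[symmetric]
    by (simp add: sum_distrib_left case_prod_unfold sum_subtractf power2_eq_square)
  also have "exp \<dots> = (\<Prod>(i, j)\<in>{1..N} \<times> {1..N}. exp (x * (\<sigma> i * \<sigma> j) - 2 * x\<^sup>2))"
    by (subst exp_sum) (auto intro!: prod.cong)
  also have "\<dots> \<le> tilt N x \<sigma>"
    unfolding tilt_def
  proof (intro prod_mono, clarify)
    fix i j assume ij: "i \<in> {1..N}" "j \<in> {1..N}"
    define y where "y = x * (\<sigma> i * \<sigma> j)"
    have y: "\<bar>y\<bar> \<le> 1/2" "y\<^sup>2 = x\<^sup>2"
      using spin_pair_product[OF assms(1) ij] assms(2,3) by (auto simp: y_def)
    have "y - 2 * x\<^sup>2 \<le> ln (1 + y)"
      using abs_ln_one_plus_x_minus_x_bound[OF y(1)] y by linarith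
    then have "exp (y - 2 * x\<^sup>2) \<le> 1 + y"
      using y(1) by (subst ln_ge_iff[symmetric]) linarith+
    then show "0 \<le> exp (x * (\<sigma> i * \<sigma> j) - 2 * x\<^sup>2) \<and>
        exp (x * (\<sigma> i * \<sigma> j) - 2 * x\<^sup>2) \<le> 1 + x * (\<sigma> i * \<sigma> j)"
      by (simp add: y_def)
  qed
  finally show ?thesis .
qed

section \<open>Joint weight of two replicas on the same graph\<close>

definition tilt2 :: "nat \<Rightarrow> real \<Rightarrow> real \<Rightarrow> (nat \<Rightarrow> real) \<Rightarrow> (nat \<Rightarrow> real) \<Rightarrow> real" where
  "tilt2 N p t \<sigma> \<tau> = (\<Prod>(i, j)\<in>{1..N} \<times> {1..N}.
     1 + p * t * (\<sigma> i * \<sigma> j + \<tau> i * \<tau> j) + p * t\<^sup>2 * (\<sigma> i * \<sigma> j * (\<tau> i * \<tau> j)))"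

text \<open>Since \<open>1 / (1 + x a) = (1 - x a) / (1 - x\<^sup>2)\<close> for \<open>a = \<plusminus>1\<close>, the ratio of the two sides without
  the exponential is exactly one plus the exponent.\<close>

lemma two_replica_factor_le:
  fixes a b p t :: real
  assumes "a \<in> {-1, 1}" "b \<in> {-1, 1}" "0 \<le> p * t" "p * t < 1"
  shows "1 + p * t * (a + b) + p * t\<^sup>2 * (a * b) \<le> (1 + p * t * a) * (1 + p * t * b) *
    exp ((p - p\<^sup>2) * t\<^sup>2 / (1 - (p * t)\<^sup>2)\<^sup>2 * (a * b - p * t * (a + b) + (p * t)\<^sup>2))"
    (is "?L \<le> ?F * exp ?E")
proof -
  define x where "x = p * t"
  define c where "c = (p - p\<^sup>2) * t\<^sup>2 / (1 - x\<^sup>2)\<^sup>2"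
  have "x\<^sup>2 < 1" using assms by (simp add: x_def abs_square_less_1)
  hence c: "c * (1 - x\<^sup>2)\<^sup>2 = (p - p\<^sup>2) * t\<^sup>2" by (simp add: c_def)
  have sq: "a\<^sup>2 = 1" "b\<^sup>2 = 1" using assms by auto
  \<comment> \<open>The last bracket is \<open>(a - x) * (b - x)\<close>, and
    \<open>(1 + x * a) * (a - x) = a * (1 - x\<^sup>2)\<close> because \<open>a\<^sup>2 = 1\<close>;
    likewise for \<open>b\<close>.\<close>
  have "(1 + x * a) * (1 + x * b) * (a * b - x * (a + b) + x\<^sup>2) = a * b * (1 - x\<^sup>2)\<^sup>2"
    using sq by algebra
  then have "(1 + x * a) * (1 + x * b) * (1 + c * (a * b - x * (a + b) + x\<^sup>2))
      = (1 + x * a) * (1 + x * b) + a * b * (c * (1 - x\<^sup>2)\<^sup>2)"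
    by algebra
  also have "\<dots> = ?L"
    unfolding c by (simp add: x_def algebra_simps power2_eq_square)
  finally have "?L = ?F * (1 + ?E)" by (simp add: x_def c_def)
  moreover have "0 \<le> ?F" using assms by auto
  ultimately show ?thesis
    using exp_ge_add_one_self[of ?E] by (metis mult_left_mono)
qed

text \<open>Multiplying the one-pair bounds gives an exponent that sums to the squared overlap,
  minus the squared magnetisations, plus a constant. The coefficient \<open>d\<close> of the exact
  correction stays below \<open>c\<close> because \<open>p - p\<^sup>2 \<le> p\<close>.\<close>

lemma tilt2_le:
  assumes \<sigma>: "\<sigma> \<in> spin_configs N" and \<tau>: "\<tau> \<in> spin_configs N"
    and pt: "0 < p" "p \<le> 1" "0 \<le> t" "t < 1"
    and c: "p * t\<^sup>2 / (1 - (p * t)\<^sup>2)\<^sup>2 \<le> c"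
  shows "tilt2 N p t \<sigma> \<tau> \<le> tilt N (p * t) \<sigma> * tilt N (p * t) \<tau> *
    exp (c * ((\<Sum>i=1..N. \<sigma> i * \<tau> i)\<^sup>2 + (p * t * real N)\<^sup>2))"
proof -
  define x where "x = p * t"
  define d where "d = (p - p\<^sup>2) * t\<^sup>2 / (1 - x\<^sup>2)\<^sup>2"
  let ?P = "{1..N} \<times> {1..N}"
  have x: "0 \<le> x" "x < 1" using pt mult_left_le_one_le[of t p] by (auto simp: x_def)
  have d: "0 \<le> d" "d \<le> c"
  proof -
    show "0 \<le> d" using pt by (auto simp: d_def power2_eq_square intro!: divide_nonneg_nonneg mult_nonneg_nonneg mult_left_le)
    have "(p - p\<^sup>2) * t\<^sup>2 \<le> p * t\<^sup>2" by (intro mult_right_mono) auto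
    then have "d \<le> p * t\<^sup>2 / (1 - x\<^sup>2)\<^sup>2" unfolding d_def by (intro divide_right_mono) auto
    with c show "d \<le> c" by (simp add: x_def)
  qed
  let ?e = "\<lambda>i j. d * (\<sigma> i * \<sigma> j * (\<tau> i * \<tau> j) - x * (\<sigma> i * \<sigma> j + \<tau> i * \<tau> j) + x\<^sup>2)"
  have "tilt2 N p t \<sigma> \<tau> \<le> (\<Prod>(i, j)\<in>?P.
      (1 + x * (\<sigma> i * \<sigma> j)) * (1 + x * (\<tau> i * \<tau> j)) * exp (?e i j))"
    unfolding tilt2_def
  proof (intro prod_mono, clarify)
    fix i j assume ij: "i \<in> {1..N}" "j \<in> {1..N}"
    let ?a = "\<sigma> i * \<sigma> j" and ?b = "\<tau> i * \<tau> j"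
    have ab: "?a \<in> {-1, 1}" "?b \<in> {-1, 1}"
      using spin_pair_product ij \<sigma> \<tau> by blast+
    \<comment> \<open>The factor is a mean over one edge: present with probability \<open>p\<close>
      it contributes \<open>(1 + t * ?a) * (1 + t * ?b)\<close>, absent it contributes 1. So it is
      nonnegative, as the product of inequalities requires.\<close>
    have "1 + p * t * (?a + ?b) + p * t\<^sup>2 * (?a * ?b) = p * ((1 + t * ?a) * (1 + t * ?b)) + (1 - p)"
      by (simp add: algebra_simps power2_eq_square)
    moreover have "0 \<le> p * ((1 + t * ?a) * (1 + t * ?b)) + (1 - p)"
    proof -
      have "0 \<le> 1 + t * ?a" "0 \<le> 1 + t * ?b" using ab pt by auto
      then show ?thesis using pt by simp
    qed
    ultimately show "0 \<le> 1 + p * t * (?a + ?b) + p * t\<^sup>2 * (?a * ?b) \<and>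
        1 + p * t * (?a + ?b) + p * t\<^sup>2 * (?a * ?b)
        \<le> (1 + x * ?a) * (1 + x * ?b) * exp (?e i j)"
      using two_replica_factor_le[OF ab x[unfolded x_def]] by (simp add: x_def d_def)
  qed
  also have "\<dots> = tilt N x \<sigma> * tilt N x \<tau> * (\<Prod>(i, j)\<in>?P. exp (?e i j))"
    by (simp add: tilt_def prod.distrib case_prod_unfold)
  also have "(\<Prod>(i, j)\<in>?P. exp (?e i j)) = exp (\<Sum>(i, j)\<in>?P. ?e i j)"
    by (subst exp_sum) (auto intro!: prod.cong)
  also have "(\<Sum>(i, j)\<in>?P. ?e i j) = d * ((\<Sum>(i, j)\<in>?P. (\<sigma> i * \<tau> i) * (\<sigma> j * \<tau> j))
      - x * ((\<Sum>(i, j)\<in>?P. \<sigma> i * \<sigma> j) + (\<Sum>(i, j)\<in>?P. \<tau> i * \<tau> j)) + (x * real N)\<^sup>2)"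
    by (simp add: sum_distrib_left[symmetric] case_prod_unfold sum_subtractf sum.distrib
        power2_eq_square mult_ac)
  also have "\<dots> = d * ((\<Sum>i=1..N. \<sigma> i * \<tau> i)\<^sup>2
      - x * ((\<Sum>i=1..N. \<sigma> i)\<^sup>2 + (\<Sum>i=1..N. \<tau> i)\<^sup>2) + (x * real N)\<^sup>2)"
    by (simp only: sum_pairs_product)
  also have "tilt N x \<sigma> * tilt N x \<tau> * exp \<dots> \<le> tilt N x \<sigma> * tilt N x \<tau> *
      exp (c * ((\<Sum>i=1..N. \<sigma> i * \<tau> i)\<^sup>2 + (x * real N)\<^sup>2))"
  proof -
    \<comment> \<open>Both squared magnetisations enter with a negative sign and are
      discarded.\<close>
    have "d * ((\<Sum>i=1..N. \<sigma> i * \<tau> i)\<^sup>2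
      - x * ((\<Sum>i=1..N. \<sigma> i)\<^sup>2 + (\<Sum>i=1..N. \<tau> i)\<^sup>2) + (x * real N)\<^sup>2)
      \<le> d * ((\<Sum>i=1..N. \<sigma> i * \<tau> i)\<^sup>2 + (x * real N)\<^sup>2)"
      using d x by (intro mult_left_mono) auto
    also have "\<dots> \<le> c * ((\<Sum>i=1..N. \<sigma> i * \<tau> i)\<^sup>2 + (x * real N)\<^sup>2)"
      using d by (intro mult_right_mono) auto
    finally show ?thesis
      using tilt_pos[OF \<sigma> x] tilt_pos[OF \<tau> x] by (intro mult_left_mono) auto
  qed
  finally show ?thesis by (simp add: x_def)
qed

text \<open>Convexity of \<open>exp\<close> between 0 and \<open>y\<close>. It extracts a small
  factor \<open>l\<close> while an exponential of order one remains.\<close>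

lemma exp_scaled_minus_one_le:
  fixes l y :: real
  assumes "0 \<le> l" "l \<le> 1"
  shows "exp (l * y) - 1 \<le> l * exp y"
proof -
  have "exp ((1 - l) *\<^sub>R 0 + l *\<^sub>R y) \<le> (1 - l) * exp 0 + l * exp y"
    using assms by (intro convex_onD[OF exp_convex]) auto
  then show ?thesis using assms by (simp add: algebra_simps)
qed

text \<open>A convex combination is at most the larger of \<open>a\<close> and \<open>b\<close>.
  This takes the place of a Hoelder inequality when magnetisation and overlap occur in the same
  exponent.\<close>

lemma exp_convex_combination_le_add:
  fixes a b w :: real
  assumes "0 \<le> w" "w \<le> 1"
  shows "exp (w * a + (1 - w) * b) \<le> exp a + exp b"
proof -
  have "w * a + (1 - w) * b \<le> max a b"
    using assms by (intro convex_bound_le) auto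
  then have "exp (w * a + (1 - w) * b) \<le> exp (max a b)" by simp
  also have "\<dots> \<le> exp a + exp b" by (auto simp: max_def intro: add_increasing add_increasing2)
  finally show ?thesis .
qed

text \<open>Everything follows from \<open>tanh g \<le> g\<close> and
  \<open>p * g = \<beta> / (2 * real N)\<close>, where \<open>g\<close> is the argument of
  \<open>tanh\<close>.\<close>

lemma tilt_parameter_bounds:
  fixes p \<beta> :: real
  assumes "0 < \<beta>" "\<beta> < 1" "N \<ge> 1" "0 < p" "p \<le> 1"
  defines "t \<equiv> tanh (\<beta> / (2 * real N * p))"
  shows "0 \<le> t" "t < 1" "p * t \<le> \<beta> / (2 * real N)" "p * t \<le> 1/2" "p * t * real N \<le> 1/2"
    "p * t\<^sup>2 / (1 - (p * t)\<^sup>2)\<^sup>2 \<le> 1 / (2 * (real N)\<^sup>2 * p)"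
proof -
  define g where "g = \<beta> / (2 * real N * p)"
  have g: "0 \<le> g" using assms by (simp add: g_def)
  show t0: "0 \<le> t" and "t < 1"
    using g tanh_real_lt_1[of g] by (auto simp: t_def g_def)
  have tg: "t \<le> g" using tanh_le_self[OF g] by (simp add: t_def g_def)
  have pg: "p * g = \<beta> / (2 * real N)" using assms by (simp add: g_def)
  show a: "p * t \<le> \<beta> / (2 * real N)"
    using mult_left_mono[OF tg, of p] assms(4) pg by simp
  have "p * t * real N \<le> \<beta> / (2 * real N) * N" using a by (intro mult_right_mono) auto
  then show b: "p * t * real N \<le> 1/2" using assms by simp
  have "p * t * 1 \<le> p * t * real N" using t0 assms by (intro mult_left_mono) auto
  with b show c: "p * t \<le> 1/2" by simp
  have "(p * t)\<^sup>2 \<le> (1/2)\<^sup>2" using c t0 assms by (intro power_mono) auto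
  \<comment> \<open>\<open>p * t \<le> 1/2\<close> keeps the base of the denominator above
    \<open>3/4\<close>. Since
    \<open>p * g\<^sup>2 = \<beta>\<^sup>2 / (4 * (real N)\<^sup>2 * p)\<close>, the resulting
    constant is \<open>4/9 * \<beta>\<^sup>2\<close>, below \<open>1/2\<close>.\<close>
  then have "(3/4)\<^sup>2 \<le> (1 - (p * t)\<^sup>2)\<^sup>2" by (intro power_mono) (auto simp: power2_eq_square)
  then have "p * t\<^sup>2 / (1 - (p * t)\<^sup>2)\<^sup>2 \<le> p * t\<^sup>2 / (3/4)\<^sup>2"
    using assms by (intro divide_left_mono) (auto intro!: mult_pos_pos simp: power2_eq_square)
  also have "\<dots> \<le> p * g\<^sup>2 / (3/4)\<^sup>2"
    using assms tg t0 by (intro divide_right_mono mult_left_mono power_mono) auto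
  also have "\<dots> = \<beta>\<^sup>2 * (4/9) / ((real N)\<^sup>2 * p)"
    using assms by (simp add: g_def power2_eq_square field_simps)
  also have "\<dots> \<le> (1/2) / ((real N)\<^sup>2 * p)"
    using assms mult_mono[of \<beta> 1 \<beta> 1] by (intro divide_right_mono) (auto simp: power2_eq_square)
  finally show "p * t\<^sup>2 / (1 - (p * t)\<^sup>2)\<^sup>2 \<le> 1 / (2 * (real N)\<^sup>2 * p)" by simp
qed

text \<open>The coefficient \<open>1 / (2 * (real N)\<^sup>2 * p)\<close> of the squared overlap is
  split as \<open>l * d\<close>. Convexity extracts \<open>l\<close>, of order
  \<open>1 / (N * p)\<close>; \<open>d\<close>, of order \<open>1 / N\<close>, stays in the
  exponent. The lower bound on \<open>real N * p\<close> says \<open>l \<le> 1\<close>. The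
  coefficients \<open>(1 + \<beta>) / 2\<close> and \<open>1 / 2\<close> on the right are both below
  1, so the spin averages remain bounded.\<close>

lemma tilt2_minus_tilt_le:
  fixes p \<beta> :: real
  assumes \<beta>: "0 < \<beta>" "\<beta> < 1" and N: "N \<ge> 1" and p: "0 < p" "p \<le> 1"
    and Np: "2 * (1 + \<beta>) / (1 - \<beta>) \<le> real N * p"
    and \<sigma>: "\<sigma> \<in> spin_configs N" and \<tau>: "\<tau> \<in> spin_configs N"
  defines "t \<equiv> tanh (\<beta> / (2 * real N * p))"
  shows "tilt2 N p t \<sigma> \<tau> - tilt N (p * t) \<sigma> * tilt N (p * t) \<tau>
    \<le> 2 * (1 + \<beta>) / (1 - \<beta>) / (real N * p) * exp 1 *
       (exp (((1 + \<beta>) / 2) / (2 * real N) * (\<Sum>i=1..N. \<sigma> i)\<^sup>2) *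
        exp (((1 + \<beta>) / 2) / (2 * real N) * (\<Sum>i=1..N. \<tau> i)\<^sup>2)
        + exp ((1 / 2) / (2 * real N) * (\<Sum>i=1..N. \<tau> i * \<sigma> i)\<^sup>2))"
proof -
  define x where "x = p * t"
  \<comment> \<open>This value is dictated by the convex combination below: \<open>d\<close> is the
    weight \<open>1 - 2 * \<beta> / (1 + \<beta>)\<close> times the overlap coefficient
    \<open>(1 / 2) / (2 * real N)\<close>. Then \<open>l\<close> is what remains of
    \<open>1 / (2 * (real N)\<^sup>2 * p)\<close>.\<close>
  define d where "d = (1 - \<beta>) / (4 * (1 + \<beta>)) / N"
  define l where "l = 2 * (1 + \<beta>) / (1 - \<beta>) / (real N * p)"
  define Q where "Q = (\<Sum>i=1..N. \<sigma> i * \<tau> i)\<^sup>2"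
  define A where "A = (\<Sum>i=1..N. \<sigma> i)\<^sup>2"
  define B where "B = (\<Sum>i=1..N. \<tau> i)\<^sup>2"
  note bnd = tilt_parameter_bounds[OF \<beta> N p, folded t_def]
  have x: "0 \<le> x" "x \<le> 1/2" "x < 1" "x \<le> \<beta> / (2 * real N)" "(x * real N)\<^sup>2 \<le> 1"
    using bnd p by (auto simp: x_def intro!: power_le_one)
  have "0 < real N * p" using N p by simp
  then have l: "0 \<le> l" "l \<le> 1"
    unfolding l_def using \<beta> Np by (auto simp only: divide_le_eq_1_pos) auto
  have d: "0 \<le> d" "d \<le> 1"
    using \<beta> N by (auto simp: d_def divide_simps intro: order_trans[of _ "4 * (1 + \<beta>) * 1"])
  have ld: "1 / (2 * (real N)\<^sup>2 * p) = l * d"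
  proof -
    have "1 / (2 * (real N)\<^sup>2 * p) = 2 * a / b / (real N * p) * (b / (4 * a) / N)"
      if "a \<noteq> 0" "b \<noteq> 0" for a b :: real
      using that N p by (simp add: field_simps power2_eq_square)
    from this[of "1 + \<beta>" "1 - \<beta>"] show ?thesis
      using \<beta> by (simp add: l_def d_def)
  qed
  have F: "0 < tilt N x \<sigma>" "0 < tilt N x \<tau>"
    using tilt_pos \<sigma> \<tau> x by auto
  have FF: "tilt N x \<sigma> * tilt N x \<tau> \<le> exp (\<beta> / (2 * real N) * (A + B))"
  proof -
    have "tilt N x \<sigma> * tilt N x \<tau> \<le> exp (x * A) * exp (x * B)"
      unfolding A_def B_def using F tilt_le \<sigma> \<tau> x by (intro mult_mono) auto
    also have "\<dots> = exp (x * (A + B))" by (simp add: exp_add distrib_left)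
    also have "\<dots> \<le> exp (\<beta> / (2 * real N) * (A + B))"
      unfolding exp_le_cancel_iff by (intro mult_right_mono x) (auto simp: A_def B_def)
    finally show ?thesis .
  qed
  have "tilt2 N p t \<sigma> \<tau> \<le> tilt N x \<sigma> * tilt N x \<tau> * exp (l * d * (Q + (x * real N)\<^sup>2))"
    using tilt2_le[OF \<sigma> \<tau> p bnd(1,2) bnd(6)] by (simp add: ld Q_def x_def)
  \<comment> \<open>\<open>(x * real N)\<^sup>2 \<le> 1\<close> is absorbed into
    \<open>Q + 1\<close>, at the later cost of a factor \<open>exp d \<le> exp 1\<close>.\<close>
  also have "\<dots> \<le> tilt N x \<sigma> * tilt N x \<tau> * exp (l * (d * (Q + 1)))"
    using F x l d by (intro mult_left_mono) (auto simp: mult.assoc intro!: mult_left_mono)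
  finally have "tilt2 N p t \<sigma> \<tau> - tilt N x \<sigma> * tilt N x \<tau>
      \<le> tilt N x \<sigma> * tilt N x \<tau> * (exp (l * (d * (Q + 1))) - 1)"
    by (simp add: algebra_simps)
  also have "\<dots> \<le> exp (\<beta> / (2 * real N) * (A + B)) * (l * exp (d * (Q + 1)))"
    using F FF l d by (intro mult_mono exp_scaled_minus_one_le) (auto simp: Q_def)
  also have "\<dots> = l * exp d * exp (\<beta> / (2 * real N) * (A + B) + d * Q)"
    by (simp add: exp_add distrib_left)
  also have "\<dots> \<le> l * exp 1 * exp (\<beta> / (2 * real N) * (A + B) + d * Q)"
    using l d by (intro mult_right_mono mult_left_mono) auto
  \<comment> \<open>The weight \<open>2 * \<beta> / (1 + \<beta>)\<close> raises the magnetisation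
    coefficient from \<open>\<beta>\<close> to the midpoint \<open>(1 + \<beta>) / 2\<close> between
    \<open>\<beta>\<close> and 1; the complementary weight goes to the overlap.\<close>
  also have "\<beta> / (2 * real N) * (A + B) + d * Q = 
      2 * \<beta> / (1 + \<beta>) * (((1 + \<beta>) / 2) / (2 * real N) * (A + B))
      + (1 - 2 * \<beta> / (1 + \<beta>)) * ((1 / 2) / (2 * real N) * Q)"
  proof -
    have "1 - 2 * \<beta> / (1 + \<beta>) = (1 - \<beta>) / (1 + \<beta>)" using \<beta> by (simp add: field_simps)
    then show ?thesis using \<beta> N by (simp add: d_def)
  qed
  also have "l * exp 1 * exp \<dots> \<le> l * exp 1 *
      (exp (((1 + \<beta>) / 2) / (2 * real N) * (A + B)) + exp ((1 / 2) / (2 * real N) * Q))"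
    using \<beta> l by (intro mult_left_mono exp_convex_combination_le_add) auto
  also have "\<dots> = l * exp 1 *
      (exp (((1 + \<beta>) / 2) / (2 * real N) * A) * exp (((1 + \<beta>) / 2) / (2 * real N) * B) + exp ((1 / 2) / (2 * real N) * Q))"
    by (simp only: exp_add distrib_left)
  finally show ?thesis by (simp add: x_def l_def A_def B_def Q_def mult.commute[of "\<sigma> _"])
qed

text \<open>The left side will be the variance of the averaged weight. In the previous bound the
  magnetisation term factorises over the replicas, giving the square of one average, and the overlap
  term is averaged over \<open>\<tau>\<close> for each fixed \<open>\<sigma>\<close>.\<close>

lemma spin_avg_tilt2_le:
  fixes p \<beta> :: real
  assumes \<beta>: "0 < \<beta>" "\<beta> < 1" and N: "N \<ge> 1" and p: "0 < p" "p \<le> 1"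
    and Np: "2 * (1 + \<beta>) / (1 - \<beta>) \<le> real N * p"
  defines "t \<equiv> tanh (\<beta> / (2 * real N * p))"
  shows "spin_avg N (\<lambda>\<sigma>. spin_avg N (tilt2 N p t \<sigma>)) - (spin_avg N (tilt N (p * t)))\<^sup>2
    \<le> 2 * (1 + \<beta>) / (1 - \<beta>) * exp 1 * (2 / (1 - \<beta>) + 2) / (real N * p)"
proof -
  define l where "l = 2 * (1 + \<beta>) / (1 - \<beta>) / (real N * p) * exp 1"
  define E where "E \<sigma> = exp (((1 + \<beta>) / 2) / (2 * real N) * (\<Sum>i=1..N. \<sigma> i)\<^sup>2)" for \<sigma> :: "nat \<Rightarrow> real"
  define V where "V \<tau> \<sigma> = exp ((1 / 2) / (2 * real N) * (\<Sum>i=1..N. \<tau> i * \<sigma> i)\<^sup>2)" for \<sigma> \<tau> :: "nat \<Rightarrow> real"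
  have l: "0 \<le> l" using \<beta> p by (simp add: l_def)
  have E: "spin_avg N E \<le> 1 / sqrt (1 - (1 + \<beta>) / 2)"
    unfolding E_def using \<beta> N by (intro spin_avg_exp_square_magnetization_le) auto
  have E0: "0 \<le> spin_avg N E"
    using spin_avg_mono[of N "\<lambda>_. 0" E] by (simp add: spin_avg_const E_def)
  have "(spin_avg N E)\<^sup>2 \<le> (1 / sqrt (1 - (1 + \<beta>) / 2))\<^sup>2"
    by (intro power_mono E E0)
  \<comment> \<open>Squaring removes the root:
    \<open>1 - (1 + \<beta>) / 2 = (1 - \<beta>) / 2\<close>.\<close>
  also have "\<dots> = 2 / (1 - \<beta>)"
    using \<beta> by (simp add: power_divide field_simps)
  finally have E2: "(spin_avg N E)\<^sup>2 \<le> 2 / (1 - \<beta>)" .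
  have V: "spin_avg N (\<lambda>\<tau>. V \<tau> \<sigma>) \<le> 2" if "\<sigma> \<in> spin_configs N" for \<sigma>
  proof -
    have "spin_avg N (\<lambda>\<tau>. V \<tau> \<sigma>) \<le> 1 / sqrt (1 - 1 / 2)"
      unfolding V_def using N spin_configsD[OF that] by (intro spin_avg_exp_square_overlap_le) auto
    also have "\<dots> = sqrt 2" by (simp add: real_sqrt_divide)
    also have "\<dots> \<le> 2" using sqrt2_less_2 by simp
    finally show ?thesis .
  qed
  have "spin_avg N (\<lambda>\<sigma>. spin_avg N (tilt2 N p t \<sigma>)) - (spin_avg N (tilt N (p * t)))\<^sup>2
      = spin_avg N (\<lambda>\<sigma>. spin_avg N (\<lambda>\<tau>. tilt2 N p t \<sigma> \<tau> - tilt N (p * t) \<sigma> * tilt N (p * t) \<tau>))"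
    by (simp add: spin_avg_diff spin_avg_cmult spin_avg_multc power2_eq_square)
  also have "\<dots> \<le> spin_avg N (\<lambda>\<sigma>. spin_avg N (\<lambda>\<tau>. l * (E \<sigma> * E \<tau> + V \<tau> \<sigma>)))"
    unfolding l_def E_def V_def t_def
    by (intro spin_avg_mono tilt2_minus_tilt_le[OF \<beta> N p Np])
  also have "\<dots> = l * ((spin_avg N E)\<^sup>2 + spin_avg N (\<lambda>\<sigma>. spin_avg N (\<lambda>\<tau>. V \<tau> \<sigma>)))"
    by (simp add: spin_avg_add spin_avg_cmult spin_avg_multc power2_eq_square)
  also have "\<dots> \<le> l * (2 / (1 - \<beta>) + spin_avg N (\<lambda>_. 2))"
    using l by (intro mult_left_mono add_mono E2 spin_avg_mono V)
  finally show ?thesis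
    by (simp add: l_def spin_avg_const mult_ac)
qed

text \<open>For the lower bound, \<open>p * t * real N \<le> 1/2\<close> makes the loss in
  \<open>tilt_ge\<close> at most \<open>1/2\<close>. For the upper bound,
  \<open>p * t \<le> \<beta> / (2 * real N)\<close> allows the exponential moment with
  \<open>\<theta> = \<beta>\<close>.\<close>

lemma spin_avg_tilt_bounds:
  fixes p \<beta> :: real
  assumes \<beta>: "0 < \<beta>" "\<beta> < 1" and N: "N \<ge> 1" and p: "0 < p" "p \<le> 1"
  defines "t \<equiv> tanh (\<beta> / (2 * real N * p))"
  shows "exp (-1) \<le> spin_avg N (tilt N (p * t))"
    and "spin_avg N (tilt N (p * t)) \<le> 1 / sqrt (1 - \<beta>)"
proof -
  define x where "x = p * t"
  note bnd = tilt_parameter_bounds[OF \<beta> N p, folded t_def]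
  have x: "0 \<le> x" "x \<le> 1/2" "x < 1" "x \<le> \<beta> / (2 * real N)"
    using bnd p by (auto simp: x_def)
  have "(x * real N)\<^sup>2 \<le> (1/2)\<^sup>2"
    using bnd(5) x by (intro power_mono) (auto simp: x_def)
  then have "exp (-1) \<le> exp (- 2 * x\<^sup>2 * (real N)\<^sup>2)"
    by (simp add: power_mult_distrib power_divide)
  then have "exp (-1) \<le> tilt N x \<sigma>" if "\<sigma> \<in> spin_configs N" for \<sigma>
    using tilt_ge[OF that x(1,2)] by linarith
  then show "exp (-1) \<le> spin_avg N (tilt N (p * t))"
    using spin_avg_mono[of N "\<lambda>_. exp (-1)" "tilt N x"] by (simp add: spin_avg_const x_def)
  have "spin_avg N (tilt N x) \<le> spin_avg N (\<lambda>\<sigma>. exp (\<beta> / (2 * real N) * (\<Sum>i=1..N. \<sigma> i)\<^sup>2))"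
  proof (rule spin_avg_mono)
    fix \<sigma> assume "\<sigma> \<in> spin_configs N"
    then have "tilt N x \<sigma> \<le> exp (x * (\<Sum>i=1..N. \<sigma> i)\<^sup>2)" using tilt_le x by blast
    also have "\<dots> \<le> exp (\<beta> / (2 * real N) * (\<Sum>i=1..N. \<sigma> i)\<^sup>2)"
      unfolding exp_le_cancel_iff by (intro mult_right_mono x) auto
    finally show "tilt N x \<sigma> \<le> exp (\<beta> / (2 * real N) * (\<Sum>i=1..N. \<sigma> i)\<^sup>2)" .
  qed
  also have "\<dots> \<le> 1 / sqrt (1 - \<beta>)"
    using \<beta> N by (intro spin_avg_exp_square_magnetization_le) auto
  finally show "spin_avg N (tilt N (p * t)) \<le> 1 / sqrt (1 - \<beta>)" by (simp add: x_def)
qed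

section \<open>The random partition function\<close>

lemma borel_measurable_tanh [measurable]: "(tanh :: real \<Rightarrow> real) \<in> borel_measurable borel"
  by (intro borel_measurable_continuous_onI continuous_intros) auto

lemma borel_measurable_cosh [measurable]: "(cosh :: real \<Rightarrow> real) \<in> borel_measurable borel"
  by (intro borel_measurable_continuous_onI continuous_intros)

text \<open>The two atoms carry total mass 1, so \<open>g (X \<omega>)\<close> is almost everywhere
  a combination of two indicators. The codomain is a Banach space so that real moments and complex
  characteristic functions are both covered.\<close>

lemma (in prob_space) has_bochner_integral_bernoulli:
  fixes g :: "real \<Rightarrow> 'b :: {banach, second_countable_topology}"
  assumes [measurable]: "random_variable borel X" "g \<in> borel_measurable borel"
    and p: "prob {\<omega> \<in> space M. X \<omega> = 1} = p" "prob {\<omega> \<in> space M. X \<omega> = 0} = 1 - p"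
  shows "has_bochner_integral M (\<lambda>\<omega>. g (X \<omega>)) (p *\<^sub>R g 1 + (1 - p) *\<^sub>R g 0)"
proof -
  let ?A = "{\<omega> \<in> space M. X \<omega> = 1}" and ?B = "{\<omega> \<in> space M. X \<omega> = 0}"
  have [measurable]: "?A \<in> sets M" "?B \<in> sets M" by measurable
  have "prob (?A \<union> ?B) = 1"
    using p by (subst finite_measure_Union) auto
  then have "AE \<omega> in M. \<omega> \<in> ?A \<union> ?B"
    by (subst AE_in_set_eq_1) auto
  then have ae: "AE \<omega> in M. indicator ?A \<omega> *\<^sub>R g 1 + indicator ?B \<omega> *\<^sub>R g 0 = g (X \<omega>)"
    by eventually_elim auto
  have "has_bochner_integral M (\<lambda>\<omega>. indicator ?A \<omega> *\<^sub>R g 1 + indicator ?B \<omega> *\<^sub>R g 0)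
      (p *\<^sub>R g 1 + (1 - p) *\<^sub>R g 0)"
    using has_bochner_integral_real_indicator[of ?A M] has_bochner_integral_real_indicator[of ?B M]
    unfolding p by (intro has_bochner_integral_add has_bochner_integral_scaleR_left)
      (auto simp: emeasure_eq_measure)
  then show ?thesis
    by (subst has_bochner_integral_cong_AE[OF _ _ ae, symmetric]) auto
qed

text \<open>A quantitative Slutsky estimate: \<open>iexp (u * R) - 1\<close> has modulus at most
  \<open>\<bar>u\<bar> * r\<close> where \<open>\<bar>R\<bar> \<le> r\<close>, and at most 2
  elsewhere.\<close>

lemma (in prob_space) cmod_char_perturbation_le:
  fixes T R :: "'a \<Rightarrow> real"
  assumes [measurable]: "random_variable borel T" "random_variable borel R" and "0 \<le> r"
  shows "cmod (char (distr M borel (\<lambda>\<omega>. T \<omega> + R \<omega>)) u - char (distr M borel T) u)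
    \<le> \<bar>u\<bar> * r + 2 * prob {\<omega> \<in> space M. r < \<bar>R \<omega>\<bar>}"
proof -
  let ?B = "{\<omega> \<in> space M. r < \<bar>R \<omega>\<bar>}"
  have [measurable]: "?B \<in> sets M" by measurable
  have int: "integrable M (\<lambda>\<omega>. iexp (u * (T \<omega> + R \<omega>)))" "integrable M (\<lambda>\<omega>. iexp (u * T \<omega>))"
    by (rule integrable_const_bound[where B=1]; simp)+
  have "char (distr M borel (\<lambda>\<omega>. T \<omega> + R \<omega>)) u - char (distr M borel T) u
      = expectation (\<lambda>\<omega>. iexp (u * (T \<omega> + R \<omega>)) - iexp (u * T \<omega>))"
    unfolding char_def using int by (simp add: integral_distr)
  also have "cmod \<dots> \<le> expectation (\<lambda>\<omega>. \<bar>u\<bar> * r + 2 * indicator ?B \<omega>)"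
  proof (rule order_trans[OF integral_norm_bound integral_mono])
    show "integrable M (\<lambda>\<omega>. cmod (iexp (u * (T \<omega> + R \<omega>)) - iexp (u * T \<omega>)))"
      using int by (intro integrable_norm Bochner_Integration.integrable_diff)
    show "integrable M (\<lambda>\<omega>. \<bar>u\<bar> * r + 2 * indicator ?B \<omega>)"
      by (intro Bochner_Integration.integrable_add integrable_const
          Bochner_Integration.integrable_mult_right integrable_real_indicator)
         (auto simp: emeasure_eq_measure)
    fix \<omega> assume \<omega>: "\<omega> \<in> space M"
    have "iexp (u * (T \<omega> + R \<omega>)) - iexp (u * T \<omega>) = iexp (u * T \<omega>) * (iexp (u * R \<omega>) - 1)"
      by (simp add: algebra_simps exp_add)
    then have *: "cmod (iexp (u * (T \<omega> + R \<omega>)) - iexp (u * T \<omega>)) = cmod (iexp (u * R \<omega>) - 1)"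
      by (simp add: norm_mult)
    show "cmod (iexp (u * (T \<omega> + R \<omega>)) - iexp (u * T \<omega>)) \<le> \<bar>u\<bar> * r + 2 * indicator ?B \<omega>"
    proof (cases "\<omega> \<in> ?B")
      case True
      have "cmod (iexp (u * R \<omega>) - 1) \<le> 1 + 1"
        by (rule order_trans[OF norm_triangle_ineq4]) simp
      moreover have "0 \<le> \<bar>u\<bar> * r" using \<open>0 \<le> r\<close> by simp
      ultimately show ?thesis using True unfolding * by simp
    next
      case False
      have "cmod (iexp (u * R \<omega>) - 1) \<le> \<bar>u\<bar> * \<bar>R \<omega>\<bar>"
        using iexp_approx1[of "u * R \<omega>" 0] by (simp add: abs_mult)
      also have "\<dots> \<le> \<bar>u\<bar> * r"
        using False \<omega> by (intro mult_left_mono) auto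
      finally show ?thesis using False unfolding * by simp
    qed
  qed
  also have "\<dots> = \<bar>u\<bar> * r + 2 * prob ?B"
    by (subst Bochner_Integration.integral_add) (auto simp: prob_space emeasure_eq_measure)
  finally show ?thesis .
qed

section \<open>Splitting the partition function into cosh and tanh factors\<close>

definition tanh_weight :: "nat \<Rightarrow> real \<Rightarrow> (nat \<Rightarrow> nat \<Rightarrow> real) \<Rightarrow> (nat \<Rightarrow> real) \<Rightarrow> real" where
  "tanh_weight N g e \<sigma> = (\<Prod>(i, j)\<in>{1..N} \<times> {1..N}. 1 + tanh (g * e i j) * (\<sigma> i * \<sigma> j))"

lemma spin_factor_pos:
  fixes s y :: real
  assumes "s \<in> {-1, 1}"
  shows "0 < 1 + tanh y * s"
  using assms tanh_real_lt_1[of y] tanh_real_gt_neg1[of y] by auto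

lemma tanh_weight_pos: "\<sigma> \<in> spin_configs N \<Longrightarrow> 0 < tanh_weight N g e \<sigma>"
  unfolding tanh_weight_def by (intro prod_pos) (auto intro!: spin_factor_pos dest: spin_pair_product)

lemma spin_avg_pos:
  assumes "\<And>\<sigma>. \<sigma> \<in> spin_configs N \<Longrightarrow> 0 < f \<sigma>"
  shows "0 < spin_avg N f"
proof -
  have "spin_configs N \<noteq> {}"
    using card_spin_configs[of N] by auto
  then show ?thesis
    unfolding spin_avg_def using assms by (intro divide_pos_pos sum_pos) auto
qed

lemma exp_spin_mult:
  fixes s y :: real
  assumes "s \<in> {-1, 1}"
  shows "exp (y * s) = cosh y * (1 + tanh y * s)"
proof -
  have "cosh y * (1 + tanh y * s) = cosh y + sinh y * s"
    using cosh_real_pos[of y] by (simp add: tanh_def field_simps)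
  also have "\<dots> = exp (y * s)"
    using assms by (auto simp: cosh_plus_sinh cosh_minus_sinh)
  finally show ?thesis by simp
qed

text \<open>In each pair factor \<open>exp (g * e i j * (\<sigma> i * \<sigma> j))\<close> the
  \<open>cosh\<close> part does not depend on the spins and leaves the sum over
  configurations.\<close>

lemma partition_fun_eq:
  fixes \<beta> p :: real
  assumes "N \<ge> 1" "0 < p"
  defines "g \<equiv> \<beta> / (2 * real N * p)"
  shows "partition_fun N p e \<beta> =
    2 ^ N * (\<Prod>(i, j)\<in>{1..N} \<times> {1..N}. cosh (g * e i j)) * spin_avg N (tanh_weight N g e)"
proof -
  have "exp (- \<beta> * hamiltonian N p e \<sigma>) =
      (\<Prod>(i, j)\<in>{1..N} \<times> {1..N}. cosh (g * e i j)) * tanh_weight N g e \<sigma>"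
    if \<sigma>: "\<sigma> \<in> spin_configs N" for \<sigma>
  proof -
    have "- \<beta> * hamiltonian N p e \<sigma> = (\<Sum>(i, j)\<in>{1..N} \<times> {1..N}. g * e i j * (\<sigma> i * \<sigma> j))"
      by (simp add: hamiltonian_def g_def sum.cartesian_product sum_distrib_left case_prod_unfold mult_ac)
    then have "exp (- \<beta> * hamiltonian N p e \<sigma>)
        = (\<Prod>(i, j)\<in>{1..N} \<times> {1..N}. exp (g * e i j * (\<sigma> i * \<sigma> j)))"
      by (simp add: exp_sum case_prod_unfold)
    also have "\<dots> = (\<Prod>(i, j)\<in>{1..N} \<times> {1..N}.
        cosh (g * e i j) * (1 + tanh (g * e i j) * (\<sigma> i * \<sigma> j)))"
      by (intro prod.cong refl) (clarify, intro exp_spin_mult spin_pair_product[OF \<sigma>])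
    finally show ?thesis
      by (simp add: tanh_weight_def prod.distrib case_prod_unfold)
  qed
  then show ?thesis
    by (simp add: partition_fun_def spin_avg_def sum_distrib_left[symmetric])
qed

text \<open>The centring term is shared equally among the \<open>N\<^sup>2\<close> ordered pairs.
  For a Bernoulli edge, \<open>p * ln (cosh g)\<close> is the mean of
  \<open>ln (cosh (g * e i j))\<close>.\<close>

lemma ln_partition_fun:
  fixes \<beta> p :: real
  assumes "N \<ge> 1" "0 < p"
  defines "g \<equiv> \<beta> / (2 * real N * p)"
  shows "ln (partition_fun N p e \<beta>) - real N * ln 2 - real N ^ 2 * p * ln (cosh g) =
    (\<Sum>(i, j)\<in>{1..N} \<times> {1..N}. ln (cosh (g * e i j)) - p * ln (cosh g))
    + ln (spin_avg N (tanh_weight N g e))"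
proof -
  have c: "0 < (\<Prod>(i, j)\<in>{1..N} \<times> {1..N}. cosh (g * e i j))"
    by (intro prod_pos) auto
  have "ln (\<Prod>(i, j)\<in>{1..N} \<times> {1..N}. cosh (g * e i j))
      = (\<Sum>(i, j)\<in>{1..N} \<times> {1..N}. ln (cosh (g * e i j)))"
    by (subst ln_prod) (auto simp: case_prod_unfold)
  moreover have "0 < spin_avg N (tanh_weight N g e)"
    by (intro spin_avg_pos tanh_weight_pos)
  ultimately show ?thesis
    unfolding partition_fun_eq[OF assms(1,2)] using c
    by (simp add: g_def[symmetric] ln_mult ln_realpow sum_subtractf case_prod_unfold power2_eq_square)
qed

section \<open>Moments over the random graph for one fixed \<open>N\<close>, with explicit
  constants\<close>

locale directed_er_ising = prob_space M for M :: "'a measure" +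
  fixes N :: nat and p :: real and \<epsilon> :: "nat \<Rightarrow> nat \<Rightarrow> 'a \<Rightarrow> real" and \<beta> :: real
  assumes graph: "directed_erdos_renyi M N p \<epsilon>"
    and N: "N \<ge> 1" and p: "0 < p" "p \<le> 1" and \<beta>: "0 < \<beta>" "\<beta> < 1"
begin

definition g :: real where "g = \<beta> / (2 * real N * p)"

definition W :: "'a \<Rightarrow> real" where
  "W \<omega> = spin_avg N (tanh_weight N g (\<lambda>i j. \<epsilon> i j \<omega>))"

lemma indep: "indep_vars (\<lambda>_. borel) (\<lambda>(i, j). \<epsilon> i j) ({1..N} \<times> {1..N})"
  using graph by (simp add: directed_erdos_renyi_def)

lemma rv [measurable]: "i \<in> {1..N} \<Longrightarrow> j \<in> {1..N} \<Longrightarrow> random_variable borel (\<epsilon> i j)"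
  using indep unfolding indep_vars_def2 by auto

lemma has_bochner_integral_edge:
  fixes f :: "real \<Rightarrow> 'b :: {banach, second_countable_topology}"
  assumes "f \<in> borel_measurable borel" "i \<in> {1..N}" "j \<in> {1..N}"
  shows "has_bochner_integral M (\<lambda>\<omega>. f (\<epsilon> i j \<omega>)) (p *\<^sub>R f 1 + (1 - p) *\<^sub>R f 0)"
  using graph assms
  by (intro has_bochner_integral_bernoulli rv) (auto simp: directed_erdos_renyi_def)

text \<open>Independence of the edges exchanges expectation and product; each factor is then a
  two-point average.\<close>

lemma has_bochner_integral_prod_edges:
  fixes f :: "nat \<Rightarrow> nat \<Rightarrow> real \<Rightarrow> real"
  assumes f: "\<And>i j. f i j \<in> borel_measurable borel"
  shows "has_bochner_integral M (\<lambda>\<omega>. \<Prod>(i, j)\<in>{1..N} \<times> {1..N}. f i j (\<epsilon> i j \<omega>))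
    (\<Prod>(i, j)\<in>{1..N} \<times> {1..N}. p * f i j 1 + (1 - p) * f i j 0)"
proof -
  let ?P = "{1..N} \<times> {1..N}"
  have "indep_vars (\<lambda>_. borel) (\<lambda>k \<omega>. case_prod f k ((case k of (i, j) \<Rightarrow> \<epsilon> i j) \<omega>)) ?P"
    by (rule indep_vars_compose2[OF indep]) (use f in auto)
  then have i: "indep_vars (\<lambda>_. borel) (\<lambda>(i, j) \<omega>. f i j (\<epsilon> i j \<omega>)) ?P"
    by (simp add: case_prod_unfold)
  have int: "integrable M ((\<lambda>(i, j) \<omega>. f i j (\<epsilon> i j \<omega>)) k)" if "k \<in> ?P" for k
    using that has_bochner_integral_edge[OF f] by (auto simp: has_bochner_integral_iff)
  have *: "(\<lambda>\<omega>. \<Prod>(i, j)\<in>?P. f i j (\<epsilon> i j \<omega>)) = (\<lambda>\<omega>. \<Prod>k\<in>?P. (\<lambda>(i, j) \<omega>. f i j (\<epsilon> i j \<omega>)) k \<omega>)"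
    by (simp add: case_prod_unfold)
  have "expectation (\<lambda>\<omega>. \<Prod>(i, j)\<in>?P. f i j (\<epsilon> i j \<omega>))
      = (\<Prod>k\<in>?P. expectation ((\<lambda>(i, j) \<omega>. f i j (\<epsilon> i j \<omega>)) k))"
    unfolding * by (rule indep_vars_lebesgue_integral) (use i int in auto)
  also have "\<dots> = (\<Prod>(i, j)\<in>?P. p * f i j 1 + (1 - p) * f i j 0)"
    using has_bochner_integral_edge[OF f]
    by (intro prod.cong) (auto simp: has_bochner_integral_iff)
  finally have "expectation (\<lambda>\<omega>. \<Prod>(i, j)\<in>?P. f i j (\<epsilon> i j \<omega>))
      = (\<Prod>(i, j)\<in>?P. p * f i j 1 + (1 - p) * f i j 0)" .
  moreover have "integrable M (\<lambda>\<omega>. \<Prod>(i, j)\<in>?P. f i j (\<epsilon> i j \<omega>))"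
    unfolding * by (rule indep_vars_integrable) (use i int in auto)
  ultimately show ?thesis by (simp add: has_bochner_integral_iff)
qed

lemma has_bochner_integral_tanh_weight:
  "has_bochner_integral M (\<lambda>\<omega>. tanh_weight N g (\<lambda>i j. \<epsilon> i j \<omega>) \<sigma>) (tilt N (p * tanh g) \<sigma>)"
proof -
  have "has_bochner_integral M (\<lambda>\<omega>. \<Prod>(i, j)\<in>{1..N} \<times> {1..N}. 1 + tanh (g * \<epsilon> i j \<omega>) * (\<sigma> i * \<sigma> j))
      (\<Prod>(i, j)\<in>{1..N} \<times> {1..N}. p * (1 + tanh (g * 1) * (\<sigma> i * \<sigma> j))
         + (1 - p) * (1 + tanh (g * 0) * (\<sigma> i * \<sigma> j)))"
    by (rule has_bochner_integral_prod_edges) measurable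
  then show ?thesis
    by (simp add: tanh_weight_def tilt_def algebra_simps)
qed

text \<open>Both replicas see the same graph, so the product of their weights is again a product of
  functions of single edges. An absent edge contributes 1 because \<open>tanh 0 = 0\<close>.\<close>

lemma has_bochner_integral_tanh_weight_mult:
  "has_bochner_integral M
    (\<lambda>\<omega>. tanh_weight N g (\<lambda>i j. \<epsilon> i j \<omega>) \<sigma> * tanh_weight N g (\<lambda>i j. \<epsilon> i j \<omega>) \<tau>)
    (tilt2 N p (tanh g) \<sigma> \<tau>)"
proof -
  have "has_bochner_integral M (\<lambda>\<omega>. \<Prod>(i, j)\<in>{1..N} \<times> {1..N}.
       (1 + tanh (g * \<epsilon> i j \<omega>) * (\<sigma> i * \<sigma> j)) * (1 + tanh (g * \<epsilon> i j \<omega>) * (\<tau> i * \<tau> j)))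
      (\<Prod>(i, j)\<in>{1..N} \<times> {1..N}.
         p * ((1 + tanh (g * 1) * (\<sigma> i * \<sigma> j)) * (1 + tanh (g * 1) * (\<tau> i * \<tau> j)))
         + (1 - p) * ((1 + tanh (g * 0) * (\<sigma> i * \<sigma> j)) * (1 + tanh (g * 0) * (\<tau> i * \<tau> j))))"
    by (rule has_bochner_integral_prod_edges) measurable
  then show ?thesis
    by (simp add: tanh_weight_def tilt2_def prod.distrib[symmetric] case_prod_unfold
        algebra_simps power2_eq_square)
qed

lemma has_bochner_integral_spin_avg:
  fixes f :: "'a \<Rightarrow> (nat \<Rightarrow> real) \<Rightarrow> real"
  assumes "\<And>\<sigma>. has_bochner_integral M (\<lambda>\<omega>. f \<omega> \<sigma>) (m \<sigma>)"
  shows "has_bochner_integral M (\<lambda>\<omega>. spin_avg N (f \<omega>)) (spin_avg N m)"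
  unfolding spin_avg_def
  by (intro has_bochner_integral_divide_zero has_bochner_integral_sum assms)

lemma has_bochner_integral_W: "has_bochner_integral M W (spin_avg N (tilt N (p * tanh g)))"
  unfolding W_def[abs_def]
  by (intro has_bochner_integral_spin_avg has_bochner_integral_tanh_weight)

text \<open>The square of a spin average is a double average over two independent replicas.\<close>

lemma has_bochner_integral_W_square:
  "has_bochner_integral M (\<lambda>\<omega>. (W \<omega>)\<^sup>2) (spin_avg N (\<lambda>\<sigma>. spin_avg N (tilt2 N p (tanh g) \<sigma>)))"
proof -
  have "has_bochner_integral M (\<lambda>\<omega>. spin_avg N (\<lambda>\<sigma>. spin_avg N (\<lambda>\<tau>.
      tanh_weight N g (\<lambda>i j. \<epsilon> i j \<omega>) \<sigma> * tanh_weight N g (\<lambda>i j. \<epsilon> i j \<omega>) \<tau>)))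
      (spin_avg N (\<lambda>\<sigma>. spin_avg N (tilt2 N p (tanh g) \<sigma>)))"
    by (intro has_bochner_integral_spin_avg has_bochner_integral_tanh_weight_mult)
  then show ?thesis
    by (simp add: W_def spin_avg_cmult spin_avg_multc power2_eq_square)
qed

lemma W_pos: "0 < W \<omega>"
  unfolding W_def by (intro spin_avg_pos tanh_weight_pos)

lemma W_measurable [measurable]: "random_variable borel W"
  using has_bochner_integral_W by (simp add: has_bochner_integral_iff borel_measurable_integrable)

text \<open>Chebyshev's inequality for \<open>W\<close>: a large
  \<open>\<bar>ln (W \<omega>)\<bar>\<close> forces \<open>W\<close> a fixed distance away from its
  mean \<open>m\<close>, which lies between two positive constants.\<close>

lemma prob_ln_W_le:
  assumes Np: "2 * (1 + \<beta>) / (1 - \<beta>) \<le> real N * p"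
  shows "prob {\<omega> \<in> space M. 2 + 1 / sqrt (1 - \<beta>) < \<bar>ln (W \<omega>)\<bar>}
    \<le> 2 * (1 + \<beta>) / (1 - \<beta>) * exp 1 * (2 / (1 - \<beta>) + 2) / (real N * p) / (exp (-1) / 2)\<^sup>2"
proof -
  define K where "K = 2 + 1 / sqrt (1 - \<beta>)"
  define m where "m = expectation W"
  have K: "2 \<le> K" using \<beta> by (simp add: K_def)
  have m_eq: "m = spin_avg N (tilt N (p * tanh g))"
    using has_bochner_integral_W by (simp add: m_def has_bochner_integral_iff)
  have m: "exp (-1) \<le> m" "m \<le> 1 / sqrt (1 - \<beta>)"
    using spin_avg_tilt_bounds[OF \<beta> N p, folded g_def] by (simp_all add: m_eq)
  have "variance W = expectation (\<lambda>\<omega>. (W \<omega>)\<^sup>2) - m\<^sup>2"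
    unfolding m_def using has_bochner_integral_W has_bochner_integral_W_square
    by (intro variance_eq) (auto simp: has_bochner_integral_iff)
  also have "\<dots> \<le> 2 * (1 + \<beta>) / (1 - \<beta>) * exp 1 * (2 / (1 - \<beta>) + 2) / (real N * p)"
    using spin_avg_tilt2_le[OF \<beta> N p Np, folded g_def] has_bochner_integral_W_square
    by (simp add: has_bochner_integral_iff m_eq)
  finally have var: "variance W \<le> 2 * (1 + \<beta>) / (1 - \<beta>) * exp 1 * (2 / (1 - \<beta>) + 2) / (real N * p)" .
  \<comment> \<open>Either \<open>W \<omega> \<ge> 1 + K\<close>, which exceeds the upper bound on
    \<open>m\<close> by 3, or \<open>W \<omega> \<le> exp (-2) \<le> exp (-1) / 2\<close>, which is
    at most half the lower bound on \<open>m\<close>.\<close>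
  have "\<bar>W \<omega> - m\<bar> \<ge> exp (-1) / 2" if large: "K < \<bar>ln (W \<omega>)\<bar>" for \<omega>
  proof -
    consider "K < ln (W \<omega>)" | "ln (W \<omega>) < - K" using large by linarith
    then show ?thesis
    proof cases
      case 1
      then have "1 + K \<le> W \<omega>"
        using exp_ge_add_one_self[of "ln (W \<omega>)"] W_pos[of \<omega>] by simp
      moreover have "exp (-1) \<le> (1::real)" by simp
      ultimately show ?thesis using m(2) unfolding K_def by linarith
    next
      case 2
      then have "ln (W \<omega>) \<le> -2" using K by simp
      then have "W \<omega> \<le> exp (-2)" using W_pos[of \<omega>] by (metis exp_le_cancel_iff exp_ln)
      also have "exp (-2) = exp (-1) * exp (-1 :: real)" by (simp add: mult_exp_exp)
      also have "\<dots> \<le> exp (-1) * (1/2)"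
        using exp_ge_add_one_self[of "1::real"] by (intro mult_left_mono) (auto simp: exp_minus field_simps)
      finally show ?thesis using m(1) by linarith
    qed
  qed
  then have "prob {\<omega> \<in> space M. K < \<bar>ln (W \<omega>)\<bar>} \<le> prob {\<omega> \<in> space M. exp (-1) / 2 \<le> \<bar>W \<omega> - m\<bar>}"
    by (intro finite_measure_mono) auto
  also have "\<dots> \<le> variance W / (exp (-1) / 2)\<^sup>2"
    unfolding m_def using has_bochner_integral_W_square
    by (intro Chebyshev_inequality) (auto simp: has_bochner_integral_iff)
  also have "\<dots> \<le> 2 * (1 + \<beta>) / (1 - \<beta>) * exp 1 * (2 / (1 - \<beta>) + 2) / (real N * p) / (exp (-1) / 2)\<^sup>2"
    by (intro divide_right_mono var) auto
  finally show ?thesis by (simp add: K_def)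
qed

text \<open>The \<open>N\<^sup>2\<close> summands are i.i.d. Since \<open>ln (cosh 0) = 0\<close>,
  each equals \<open>ln (cosh g)\<close> times a centred Bernoulli variable, with values
  \<open>1 - p\<close> and \<open>- p\<close>.\<close>

lemma char_sum_ln_cosh:
  "char (distr M borel (\<lambda>\<omega>. a * (\<Sum>(i, j)\<in>{1..N} \<times> {1..N}. ln (cosh (g * \<epsilon> i j \<omega>)) - p * ln (cosh g)))) u
    = (p * iexp (u * a * ln (cosh g) * (1 - p)) + (1 - p) * iexp (- (u * a * ln (cosh g) * p))) ^ (N\<^sup>2)"
proof -
  let ?P = "{1..N} \<times> {1..N}"
  let ?f = "\<lambda>x. a * (ln (cosh (g * x)) - p * ln (cosh g))"
  let ?X = "\<lambda>k \<omega>. ?f ((case k of (i, j) \<Rightarrow> \<epsilon> i j) \<omega>)"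
  have i: "indep_vars (\<lambda>_. borel) ?X ?P"
    by (rule indep_vars_compose2[OF indep]) measurable
  have "char (distr M borel (\<lambda>\<omega>. a * (\<Sum>(i, j)\<in>?P. ln (cosh (g * \<epsilon> i j \<omega>)) - p * ln (cosh g)))) u
      = char (distr M borel (\<lambda>\<omega>. \<Sum>k\<in>?P. ?X k \<omega>)) u"
    by (simp add: sum_distrib_left case_prod_unfold)
  also have "\<dots> = (\<Prod>k\<in>?P. char (distr M borel (?X k)) u)"
    by (rule char_distr_sum[OF i])
  also have "\<dots> = (\<Prod>k\<in>?P. p * iexp (u * a * ln (cosh g) * (1 - p))
      + (1 - p) * iexp (- (u * a * ln (cosh g) * p)))"
  proof (rule prod.cong[OF refl])
    fix k assume "k \<in> ?P"
    then obtain i j where k: "k = (i, j)" "i \<in> {1..N}" "j \<in> {1..N}" by auto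
    have "char (distr M borel (?X k)) u = expectation (\<lambda>\<omega>. iexp (u * ?f (\<epsilon> i j \<omega>)))"
      unfolding char_def using k by (subst integral_distr) auto
    also have "\<dots> = p *\<^sub>R iexp (u * ?f 1) + (1 - p) *\<^sub>R iexp (u * ?f 0)"
      using k by (intro has_bochner_integral_integral_eq has_bochner_integral_edge) measurable
    also have "\<dots> = p * iexp (u * a * ln (cosh g) * (1 - p))
      + (1 - p) * iexp (- (u * a * ln (cosh g) * p))"
      by (simp add: scaleR_conv_of_real algebra_simps)
    finally show "char (distr M borel (?X k)) u = p * iexp (u * a * ln (cosh g) * (1 - p))
      + (1 - p) * iexp (- (u * a * ln (cosh g) * p))" .
  qed
  finally show ?thesis by (simp add: power2_eq_square)
qed

end

section \<open>Characteristic functions\<close>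

lemma cmod_iexp_quadratic_le: "cmod (iexp x - (1 + \<i> * x - x\<^sup>2 / 2)) \<le> \<bar>x\<bar> ^ 3 / 6"
  using iexp_approx1[of x 2] by (simp add: eval_nat_numeral field_simps)

lemma abs_exp_minus_linear_le:
  fixes y :: real
  assumes "0 \<le> y"
  shows "\<bar>exp (- y) - (1 - y)\<bar> \<le> y\<^sup>2"
proof -
  have "1 - y \<le> exp (- y)" using exp_ge_add_one_self[of "- y"] by simp
  moreover have "exp (- y) \<le> 1 - y + y\<^sup>2"
  proof -
    have "exp (- y) \<le> 1 / (1 + y)"
      using assms exp_ge_add_one_self[of y] by (simp add: exp_minus field_simps)
    also have "\<dots> \<le> 1 - y + y\<^sup>2"
    proof -
      have "(1 - y + y\<^sup>2) * (1 + y) = 1 + y ^ 3"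
        by (simp add: algebra_simps power2_eq_square power3_eq_cube)
      then show ?thesis using assms by (simp add: pos_divide_le_eq)
    qed
    finally show ?thesis .
  qed
  ultimately show ?thesis by simp
qed

text \<open>The characteristic function \<open>\<phi>\<close> of a scaled centred Bernoulli variable
  and \<open>exp (- y)\<close> agree up to \<open>1 - y\<close>, where \<open>2 * y\<close> is its
  variance. The distance of their \<open>n\<close>-th powers is at most \<open>n\<close> times their
  own distance because both have modulus at most 1.\<close>

lemma cmod_bernoulli_char_power_le:
  fixes p v :: real
  assumes p: "0 \<le> p" "p \<le> 1"
  shows "cmod ((p * iexp (v * (1 - p)) + (1 - p) * iexp (- (v * p))) ^ n
      - exp (- (n * (v\<^sup>2 * p * (1 - p) / 2))))
    \<le> n * (p * \<bar>v\<bar> ^ 3 / 3 + (v\<^sup>2 * p)\<^sup>2)"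
proof -
  define y where "y = v\<^sup>2 * p * (1 - p) / 2"
  define \<phi> where "\<phi> = p * iexp (v * (1 - p)) + (1 - p) * iexp (- (v * p))"
  have y: "0 \<le> y" using p by (simp add: y_def)
  have "y \<le> v\<^sup>2 * p"
    using p mult_left_mono[of "(1 - p) / 2" 1 "v\<^sup>2 * p"] by (simp add: y_def)
  then have y2: "y\<^sup>2 \<le> (v\<^sup>2 * p)\<^sup>2" using y by (intro power_mono)
  have "cmod \<phi> \<le> cmod (p * iexp (v * (1 - p))) + cmod ((1 - p) * iexp (- (v * p)))"
    unfolding \<phi>_def by (rule norm_triangle_ineq)
  also have "\<dots> = 1"
    using p norm_exp_i_times[of "v * (1 - p)"] norm_exp_i_times[of "- (v * p)"]
    by (simp add: norm_mult del: norm_exp_i_times of_real_mult of_real_minus of_real_diff)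
  finally have \<phi>1: "cmod \<phi> \<le> 1" .
  \<comment> \<open>The linear terms cancel because the variable is centred; the quadratic ones add
    up to \<open>y\<close> since
    \<open>p * (1 - p)\<^sup>2 + (1 - p) * p\<^sup>2 = p * (1 - p)\<close>.\<close>
  have "\<phi> - (1 - y) = p * (iexp (v * (1 - p)) - (1 + \<i> * (v * (1 - p)) - (v * (1 - p))\<^sup>2 / 2))
      + (1 - p) * (iexp (- (v * p)) - (1 + \<i> * (- (v * p)) - (- (v * p))\<^sup>2 / 2))"
    by (simp add: \<phi>_def y_def field_simps power2_eq_square)
  also have "cmod \<dots> \<le> p * (\<bar>v * (1 - p)\<bar> ^ 3 / 6) + (1 - p) * (\<bar>- (v * p)\<bar> ^ 3 / 6)"
  proof (rule order_trans[OF norm_triangle_ineq], rule add_mono)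
    have "cmod (of_real q * (iexp x - (1 + \<i> * x - x\<^sup>2 / 2))) \<le> q * (\<bar>x\<bar> ^ 3 / 6)"
      if "0 \<le> q" for q x :: real
      unfolding norm_mult norm_of_real abs_of_nonneg[OF that]
      by (intro mult_left_mono cmod_iexp_quadratic_le that)
    from this[of p "v * (1 - p)"] this[of "1 - p" "- (v * p)"] p
    show "cmod (p * (iexp (v * (1 - p)) - (1 + \<i> * (v * (1 - p)) - (v * (1 - p))\<^sup>2 / 2)))
        \<le> p * (\<bar>v * (1 - p)\<bar> ^ 3 / 6)"
      and "cmod ((1 - p) * (iexp (- (v * p)) - (1 + \<i> * (- (v * p)) - (- (v * p))\<^sup>2 / 2)))
        \<le> (1 - p) * (\<bar>- (v * p)\<bar> ^ 3 / 6)"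
      by simp_all
  qed
  \<comment> \<open>A factor \<open>p\<close> must survive in both cubic errors: the first has it
    already, the second has \<open>p ^ 3 \<le> p\<close>.\<close>
  also have "\<dots> \<le> p * (\<bar>v\<bar> ^ 3 / 6) + p * (\<bar>v\<bar> ^ 3 / 6)"
  proof (rule add_mono)
    have "\<bar>v * (1 - p)\<bar> ^ 3 \<le> \<bar>v\<bar> ^ 3"
      using p by (intro power_mono) (auto simp: abs_mult intro: mult_left_le)
    then show "p * (\<bar>v * (1 - p)\<bar> ^ 3 / 6) \<le> p * (\<bar>v\<bar> ^ 3 / 6)"
      using p by (intro mult_left_mono) auto
    have "(1 - p) * (\<bar>- (v * p)\<bar> ^ 3 / 6) \<le> 1 * (\<bar>- (v * p)\<bar> ^ 3 / 6)"
      using p by (intro mult_right_mono) auto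
    also have "\<dots> = p ^ 3 * (\<bar>v\<bar> ^ 3 / 6)"
      using p by (simp add: abs_mult power_mult_distrib)
    also have "\<dots> \<le> p * (\<bar>v\<bar> ^ 3 / 6)"
      using p power_decreasing[of 1 3 p] by (intro mult_right_mono) auto
    finally show "(1 - p) * (\<bar>- (v * p)\<bar> ^ 3 / 6) \<le> p * (\<bar>v\<bar> ^ 3 / 6)" .
  qed
  finally have a: "cmod (\<phi> - (1 - y)) \<le> p * \<bar>v\<bar> ^ 3 / 3" by simp
  have "cmod (exp (- y) - (1 - y)) \<le> y\<^sup>2"
  proof -
    have "exp (- y) - (1 - y) = complex_of_real (exp (- y) - (1 - y))"
      by (simp add: exp_of_real[symmetric])
    then show ?thesis
      using abs_exp_minus_linear_le[OF y] by (simp only: norm_of_real)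
  qed
  then have "cmod (\<phi> - exp (- y)) \<le> p * \<bar>v\<bar> ^ 3 / 3 + (v\<^sup>2 * p)\<^sup>2"
    using a y2 norm_triangle_ineq4[of "\<phi> - (1 - y)" "exp (- y) - (1 - y)"] by simp
  moreover have "cmod (\<phi> ^ n - complex_of_real (exp (- y)) ^ n) \<le> n * cmod (\<phi> - exp (- y))"
    using \<phi>1 y by (intro norm_power_diff) (auto simp: norm_of_real simp del: of_real_exp)
  ultimately have "cmod (\<phi> ^ n - complex_of_real (exp (- y)) ^ n) \<le> n * (p * \<bar>v\<bar> ^ 3 / 3 + (v\<^sup>2 * p)\<^sup>2)"
    by (meson mult_left_mono of_nat_0_le_iff order_trans)
  moreover have "complex_of_real (exp (- y)) ^ n = complex_of_real (exp (- (n * y)))"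
    by (simp add: exp_of_nat_mult[symmetric] flip: of_real_power)
  ultimately show ?thesis by (simp only: \<phi>_def y_def)
qed

text \<open>This normal law is the image of the standard one under multiplication by
  \<open>\<sigma>\<close>.\<close>

lemma char_normal_distribution:
  fixes \<sigma> :: real
  assumes "0 < \<sigma>"
  shows "char (density lborel (normal_density 0 \<sigma>)) t = exp (- ((\<sigma> * t)\<^sup>2 / 2))"
proof -
  have "distributed std_normal_distribution lborel (\<lambda>x. x) std_normal_density"
    by (simp add: distributed_def distr_id2)
  from prob_space.normal_density_affine[OF prob_space_normal_density[of 1 0] this, of \<sigma> 0]
  have "distributed std_normal_distribution lborel (\<lambda>x. \<sigma> * x) (normal_density 0 \<sigma>)"
    using assms by simp
  then have "density lborel (normal_density 0 \<sigma>) = distr std_normal_distribution lborel (\<lambda>x. \<sigma> * x)"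
    using assms by (simp add: distributed_def)
  then have "char (density lborel (normal_density 0 \<sigma>)) t = char std_normal_distribution (\<sigma> * t)"
    by (simp add: char_def integral_distr mult_ac)
  then show ?thesis by (simp add: char_std_normal_distribution)
qed

lemma real_distribution_normal:
  "0 < \<sigma> \<Longrightarrow> real_distribution (density lborel (normal_density \<mu> \<sigma>))"
  using prob_space_normal_density by (auto simp: real_distribution_def real_distribution_axioms_def)

lemma weak_conv_m_Suc: "weak_conv_m (\<lambda>n. \<mu> (Suc n)) \<nu> \<Longrightarrow> weak_conv_m \<mu> \<nu>"
  unfolding weak_conv_m_def weak_conv_def
  using filterlim_sequentially_Suc by blast

lemma tendsto_ln_cosh_over_square: "((\<lambda>x::real. ln (cosh x) / x\<^sup>2) \<longlongrightarrow> 1 / 2) (at_right 0)"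
  unfolding cosh_field_def by real_asymp

section \<open>Characteristic function of the centred free energy for one fixed
  \<open>N\<close>\<close>

context directed_er_ising
begin

definition free_energy :: "'a \<Rightarrow> real" where
  "free_energy \<omega> = ln (partition_fun N p (\<lambda>i j. \<epsilon> i j \<omega>) \<beta>) - real N * ln 2
     - real N ^ 2 * p * ln (cosh (\<beta> / (2 * real N * p)))"

definition edge_sum :: "'a \<Rightarrow> real" where
  "edge_sum \<omega> = (\<Sum>(i, j)\<in>{1..N} \<times> {1..N}. ln (cosh (g * \<epsilon> i j \<omega>)) - p * ln (cosh g))"

lemma free_energy_eq: "free_energy \<omega> = edge_sum \<omega> + ln (W \<omega>)"
  using ln_partition_fun[OF N p(1), of "\<lambda>i j. \<epsilon> i j \<omega>" \<beta>]
  by (simp add: free_energy_def edge_sum_def W_def g_def)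

lemma edge_sum_measurable [measurable]: "random_variable borel edge_sum"
  unfolding edge_sum_def[abs_def] case_prod_unfold
  by (intro borel_measurable_sum) (auto intro!: measurable_compose[OF rv])

lemma free_energy_measurable [measurable]: "random_variable borel free_energy"
  unfolding free_energy_eq[abs_def] by measurable

text \<open>The first summand on the right is the Gaussian approximation error of the edge sum. The
  others are the price of dropping \<open>a * ln (W \<omega>)\<close>: its typical size, and the
  probability that it is larger.\<close>

lemma cmod_char_free_energy_le:
  fixes a u :: real
  assumes Np: "2 * (1 + \<beta>) / (1 - \<beta>) \<le> real N * p" and a: "0 < a"
  defines "v \<equiv> u * a * ln (cosh g)"
  shows "cmod (char (distr M borel (\<lambda>\<omega>. a * free_energy \<omega>)) u
      - exp (- ((real N)\<^sup>2 * (v\<^sup>2 * p * (1 - p) / 2))))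
    \<le> (real N)\<^sup>2 * (p * \<bar>v\<bar> ^ 3 / 3 + (v\<^sup>2 * p)\<^sup>2) + (\<bar>u\<bar> * (a * (2 + 1 / sqrt (1 - \<beta>)))
      + 2 * (2 * (1 + \<beta>) / (1 - \<beta>) * exp 1 * (2 / (1 - \<beta>) + 2) / (real N * p) / (exp (-1) / 2)\<^sup>2))"
proof -
  define K where "K = 2 + 1 / sqrt (1 - \<beta>)"
  define C where "C = 2 * (1 + \<beta>) / (1 - \<beta>) * exp 1 * (2 / (1 - \<beta>) + 2) / (real N * p) / (exp (-1) / 2)\<^sup>2"
  have K: "0 \<le> K" using \<beta> by (simp add: K_def)
  have "cmod (char (distr M borel (\<lambda>\<omega>. a * edge_sum \<omega> + a * ln (W \<omega>))) u
      - char (distr M borel (\<lambda>\<omega>. a * edge_sum \<omega>)) u)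
    \<le> \<bar>u\<bar> * (a * K) + 2 * prob {\<omega> \<in> space M. a * K < \<bar>a * ln (W \<omega>)\<bar>}"
    using a K by (intro cmod_char_perturbation_le) auto
  also have "{\<omega> \<in> space M. a * K < \<bar>a * ln (W \<omega>)\<bar>} = {\<omega> \<in> space M. K < \<bar>ln (W \<omega>)\<bar>}"
    using a by (simp add: abs_mult)
  also have "prob \<dots> \<le> C"
    unfolding K_def C_def by (rule prob_ln_W_le[OF Np])
  finally have 1: "cmod (char (distr M borel (\<lambda>\<omega>. a * free_energy \<omega>)) u
      - char (distr M borel (\<lambda>\<omega>. a * edge_sum \<omega>)) u) \<le> \<bar>u\<bar> * (a * K) + 2 * C"
    by (simp add: free_energy_eq distrib_left)
  have "char (distr M borel (\<lambda>\<omega>. a * edge_sum \<omega>)) u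
      = (p * iexp (v * (1 - p)) + (1 - p) * iexp (- (v * p))) ^ (N\<^sup>2)"
    using char_sum_ln_cosh[of a u] by (simp add: edge_sum_def v_def)
  with cmod_bernoulli_char_power_le[of p v "N\<^sup>2"] p
  have 2: "cmod (char (distr M borel (\<lambda>\<omega>. a * edge_sum \<omega>)) u
      - exp (- ((real N)\<^sup>2 * (v\<^sup>2 * p * (1 - p) / 2))))
      \<le> (real N)\<^sup>2 * (p * \<bar>v\<bar> ^ 3 / 3 + (v\<^sup>2 * p)\<^sup>2)"
    by simp
  show ?thesis
    using norm_triangle_mono[OF 1 2] by (simp add: K_def C_def add.commute)
qed

end

section \<open>The central limit theorem\<close>

theorem theorem1p4:
  fixes M :: "nat \<Rightarrow> 'a measure"
    and p :: "nat \<Rightarrow> real"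
    and \<epsilon> :: "nat \<Rightarrow> nat \<Rightarrow> nat \<Rightarrow> 'a \<Rightarrow> real"
    and \<beta> :: real
  assumes p_range: "\<And>N. N \<ge> 1 \<Longrightarrow> 0 < p N \<and> p N \<le> 1"
    and graph: "\<And>N. N \<ge> 1 \<Longrightarrow> directed_erdos_renyi (M N) N (p N) (\<epsilon> N)"
    and beta: "0 < \<beta>" "\<beta> < 1"
    and Np: "filterlim (\<lambda>N. real N * p N) at_top sequentially"
    and p3N2: "(\<lambda>N. p N ^ 3 * real N ^ 2) \<longlonglongrightarrow> 0"
  shows "weak_conv_m
           (\<lambda>N. distr (M N) borel (\<lambda>\<omega>.
              real N * p N powr (3 / 2) *
                (ln (partition_fun N (p N) (\<lambda>i j. \<epsilon> N i j \<omega>) \<beta>)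
                 - real N * ln 2
                 - real N ^ 2 * p N * ln (cosh (\<beta> / (2 * real N * p N))))))
           (density lborel (\<lambda>x. ennreal (normal_density 0 (sqrt (\<beta> ^ 4 / 64)) x)))"
proof -
  define \<nu> where "\<nu> = density lborel (\<lambda>x. ennreal (normal_density 0 (sqrt (\<beta> ^ 4 / 64)) x))"
  define \<gamma> where "\<gamma> N = \<beta> / (2 * real N * p N)" for N
  define a where "a N = real N * p N powr (3 / 2)" for N
  define \<mu> where "\<mu> N = distr (M N) borel (\<lambda>\<omega>. a N *
      (ln (partition_fun N (p N) (\<lambda>i j. \<epsilon> N i j \<omega>) \<beta>) - real N * ln 2
       - real N ^ 2 * p N * ln (cosh (\<beta> / (2 * real N * p N)))))" for N
  have ising: "directed_er_ising (M N) N (p N) (\<epsilon> N) \<beta>" if "N \<ge> 1" for N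
    using graph[OF that] p_range[OF that] beta that
    by (simp add: directed_er_ising_def directed_er_ising_axioms_def directed_erdos_renyi_def)
  have \<mu>_eq: "\<mu> N = distr (M N) borel (\<lambda>\<omega>. a N * directed_er_ising.free_energy N (p N) (\<epsilon> N) \<beta> \<omega>)"
    if "N \<ge> 1" for N
    by (simp add: \<mu>_def directed_er_ising.free_energy_def[OF ising[OF that]])
  have ev1: "\<forall>\<^sub>F N in sequentially. N \<ge> (1::nat)" by (rule eventually_ge_at_top)
  have \<sigma>: "sqrt (\<beta> ^ 4 / 64) = \<beta>\<^sup>2 / 8"
    using beta by (intro real_sqrt_unique) (auto simp: power_divide power_mult[symmetric])

  \<comment> \<open>Since \<open>N \<ge> 1\<close>, already \<open>p N ^ 3\<close> tends to 0. This
    later replaces the Bernoulli variance \<open>p * (1 - p)\<close> by \<open>p\<close>.\<close>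
  have p0: "p \<longlonglongrightarrow> 0"
  proof -
    have "(\<lambda>N. p N ^ 3) \<longlonglongrightarrow> 0"
    proof (rule tendsto_sandwich[OF _ _ tendsto_const p3N2])
      show "\<forall>\<^sub>F N in sequentially. 0 \<le> p N ^ 3"
        using ev1 by eventually_elim (use p_range in force)
      show "\<forall>\<^sub>F N in sequentially. p N ^ 3 \<le> p N ^ 3 * real N ^ 2"
        using ev1
      proof eventually_elim
        case (elim N)
        then have "p N ^ 3 * 1 \<le> p N ^ 3 * real N ^ 2"
          using p_range[OF elim] by (intro mult_left_mono) auto
        then show ?case by simp
      qed
    qed
    then have "(\<lambda>N. root 3 (p N ^ 3)) \<longlonglongrightarrow> root 3 0" by (rule tendsto_real_root)
    then show ?thesis by (simp add: odd_real_root_power_cancel)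
  qed
  \<comment> \<open>The prefactor \<open>a N\<close> is the square root of
    \<open>p N ^ 3 * real N ^ 2\<close>.\<close>
  have a0: "a \<longlonglongrightarrow> 0"
  proof -
    have "(\<lambda>N. sqrt (p N ^ 3 * real N ^ 2)) \<longlonglongrightarrow> sqrt 0"
      by (intro tendsto_real_sqrt p3N2)
    moreover have "\<forall>\<^sub>F N in sequentially. sqrt (p N ^ 3 * real N ^ 2) = a N"
      using ev1
    proof eventually_elim
      case (elim N)
      then have "p N > 0" using p_range by blast
      then have "(p N powr (3 / 2))\<^sup>2 = p N ^ 3"
        by (simp add: power2_eq_square flip: powr_add)
      then have "(a N)\<^sup>2 = p N ^ 3 * real N ^ 2"
        by (simp add: a_def power_mult_distrib)
      then show ?case by (intro real_sqrt_unique) (auto simp: a_def)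
    qed
    ultimately show ?thesis by (simp add: tendsto_cong)
  qed
  have invNp: "(\<lambda>N. c / (real N * p N)) \<longlonglongrightarrow> 0" for c :: real
    by (intro tendsto_divide_0[OF tendsto_const] filterlim_at_top_imp_at_infinity Np)
  \<comment> \<open>\<open>\<gamma> N\<close> is positive and tends to 0 because
    \<open>N * p\<close> tends to infinity, so the one-sided limit of
    \<open>ln (cosh x) / x\<^sup>2\<close> applies along it.\<close>
  have "filterlim \<gamma> (at_right 0) sequentially"
    unfolding filterlim_at
  proof
    show "\<forall>\<^sub>F N in sequentially. \<gamma> N \<in> {0<..} \<and> \<gamma> N \<noteq> 0"
      using ev1
    proof eventually_elim
      case (elim N)
      then have "0 < \<gamma> N" using p_range[OF elim] beta by (simp add: \<gamma>_def)
      then show ?case by simp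
    qed
    show "\<gamma> \<longlonglongrightarrow> 0" using invNp[of "\<beta> / 2"] by (simp add: \<gamma>_def[abs_def] mult_ac)
  qed
  from filterlim_compose[OF tendsto_ln_cosh_over_square this]
  have lc: "(\<lambda>N. ln (cosh (\<gamma> N)) / (\<gamma> N)\<^sup>2) \<longlonglongrightarrow> 1 / 2" .

  have char_lim: "(\<lambda>N. char (\<mu> N) u) \<longlonglongrightarrow> char \<nu> u" for u
  proof -
    define v where "v N = u * a N * ln (cosh (\<gamma> N))" for N
    \<comment> \<open>\<open>q\<close> is the rescaled edge fluctuation \<open>N p\<^sup>1\<^sup>/\<^sup>2 v\<close>, written with \<open>N p \<gamma> = \<beta> / 2\<close>.\<close>
    define q where "q N = u * \<beta>\<^sup>2 / 4 * (ln (cosh (\<gamma> N)) / (\<gamma> N)\<^sup>2)" for N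
    define E where "E N = complex_of_real (exp (- ((real N)\<^sup>2 * ((v N)\<^sup>2 * p N * (1 - p N) / 2))))" for N
    have "q \<longlonglongrightarrow> u * \<beta>\<^sup>2 / 4 * (1 / 2)"
      unfolding q_def[abs_def] by (intro tendsto_mult tendsto_const lc)
    then have q: "q \<longlonglongrightarrow> u * \<beta>\<^sup>2 / 8" by simp
    \<comment> \<open>The powers \<open>3/2\<close> from \<open>a N\<close> and \<open>1/2\<close>
      from \<open>sqrt (p N)\<close> combine to \<open>(N * p)\<^sup>2\<close>, which is
      \<open>\<beta>\<^sup>2 / (4 * (\<gamma> N)\<^sup>2)\<close>.\<close>
    have vq: "(v N)\<^sup>2 * p N * (real N)\<^sup>2 = (q N)\<^sup>2" if "N \<ge> 1" for N
    proof -
      have pN: "0 < p N" "0 < real N" using p_range[OF that] that by auto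
      have "v N * sqrt (p N) * N = u * (N * N * (p N powr (3/2) * p N powr (1/2))) * ln (cosh (\<gamma> N))"
        using pN by (simp add: v_def a_def powr_half_sqrt)
      also have "p N powr (3/2) * p N powr (1/2) = (p N)\<^sup>2"
        using pN by (simp flip: powr_add)
      also have "u * (N * N * (p N)\<^sup>2) * ln (cosh (\<gamma> N)) = q N"
        using pN beta by (simp add: q_def \<gamma>_def power2_eq_square field_simps)
      finally have "(v N * sqrt (p N) * N)\<^sup>2 = (q N)\<^sup>2" by simp
      then show ?thesis using pN by (simp add: power_mult_distrib)
    qed
    \<comment> \<open>By \<open>vq\<close>, \<open>(v N)\<^sup>2\<close> is
      \<open>(q N)\<^sup>2\<close> divided by \<open>N * p\<close> and by \<open>N\<close>, with
      \<open>q\<close> convergent.\<close>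
    have v0: "(\<lambda>N. \<bar>v N\<bar>) \<longlonglongrightarrow> 0"
    proof -
      have "(\<lambda>N. sqrt ((q N)\<^sup>2 * (1 / (real N * p N)) * (1 / real N))) \<longlonglongrightarrow> sqrt ((u * \<beta>\<^sup>2 / 8)\<^sup>2 * 0 * 0)"
        by (intro tendsto_intros q invNp lim_1_over_n)
      moreover have "\<forall>\<^sub>F N in sequentially. sqrt ((q N)\<^sup>2 * (1 / (real N * p N)) * (1 / real N)) = \<bar>v N\<bar>"
        using ev1
      proof eventually_elim
        case (elim N)
        have pN: "p N \<noteq> 0" "real N \<noteq> 0" using p_range[OF elim] elim by auto
        have "(q N)\<^sup>2 * (1 / (real N * p N)) * (1 / real N) = (v N)\<^sup>2"
          unfolding vq[OF elim, symmetric] using pN by (simp add: power2_eq_square)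
        then show ?case by simp
      qed
      ultimately show ?thesis by (simp add: tendsto_cong)
    qed
    \<comment> \<open>The fixed-\<open>N\<close> error bound rewritten through \<open>vq\<close>:
      the cubic term becomes \<open>q\<^sup>2 * \<bar>v\<bar> / 3\<close> and the quartic one
      \<open>q ^ 4 / N\<^sup>2\<close>.\<close>
    have "(\<lambda>N. (q N)\<^sup>2 * \<bar>v N\<bar> / 3 + (q N)\<^sup>2 * (q N)\<^sup>2 * (1 / real N) * (1 / real N)
        + (\<bar>u\<bar> * (a N * (2 + 1 / sqrt (1 - \<beta>)))
        + 2 * (2 * (1 + \<beta>) / (1 - \<beta>) * exp 1 * (2 / (1 - \<beta>) + 2) / (real N * p N) / (exp (-1) / 2)\<^sup>2)))
      \<longlonglongrightarrow> (u * \<beta>\<^sup>2 / 8)\<^sup>2 * 0 / 3 + (u * \<beta>\<^sup>2 / 8)\<^sup>2 * (u * \<beta>\<^sup>2 / 8)\<^sup>2 * 0 * 0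
        + (\<bar>u\<bar> * (0 * (2 + 1 / sqrt (1 - \<beta>))) + 2 * (0 / (exp (-1) / 2)\<^sup>2))"
      by (intro tendsto_intros q v0 a0 invNp lim_1_over_n) auto
    then have err: "(\<lambda>N. (q N)\<^sup>2 * \<bar>v N\<bar> / 3 + (q N)\<^sup>2 * (q N)\<^sup>2 * (1 / real N) * (1 / real N)
        + (\<bar>u\<bar> * (a N * (2 + 1 / sqrt (1 - \<beta>)))
        + 2 * (2 * (1 + \<beta>) / (1 - \<beta>) * exp 1 * (2 / (1 - \<beta>) + 2) / (real N * p N) / (exp (-1) / 2)\<^sup>2)))
      \<longlonglongrightarrow> 0" by simp
    have "\<forall>\<^sub>F N in sequentially. 2 * (1 + \<beta>) / (1 - \<beta>) \<le> real N * p N"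
      using Np by (simp add: filterlim_at_top)
    with ev1 have "\<forall>\<^sub>F N in sequentially. cmod (char (\<mu> N) u - E N)
      \<le> (q N)\<^sup>2 * \<bar>v N\<bar> / 3 + (q N)\<^sup>2 * (q N)\<^sup>2 * (1 / real N) * (1 / real N)
        + (\<bar>u\<bar> * (a N * (2 + 1 / sqrt (1 - \<beta>)))
        + 2 * (2 * (1 + \<beta>) / (1 - \<beta>) * exp 1 * (2 / (1 - \<beta>) + 2) / (real N * p N) / (exp (-1) / 2)\<^sup>2))"
    proof eventually_elim
      case (elim N)
      interpret directed_er_ising "M N" N "p N" "\<epsilon> N" \<beta> by (rule ising[OF elim(1)])
      have pN: "0 < p N" "0 < real N" "0 < a N" using p_range[OF elim(1)] elim by (auto simp: a_def)
      have "(real N)\<^sup>2 * (p N * \<bar>v N\<bar> ^ 3 / 3 + ((v N)\<^sup>2 * p N)\<^sup>2)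
          = (q N)\<^sup>2 * \<bar>v N\<bar> / 3 + (q N)\<^sup>2 * (q N)\<^sup>2 * (1 / real N) * (1 / real N)"
      proof -
        have "\<bar>v N\<bar> ^ 3 = (v N)\<^sup>2 * \<bar>v N\<bar>" by (simp add: power3_eq_cube power2_eq_square)
        then show ?thesis
          unfolding vq[OF elim(1), symmetric] using pN by (simp add: field_simps power2_eq_square)
      qed
      moreover have "directed_er_ising.g N (p N) \<beta> = \<gamma> N"
        using \<gamma>_def directed_er_ising.g_def[OF ising[OF elim(1)]] by simp
      ultimately show ?case
        using cmod_char_free_energy_le[OF elim(2) pN(3), of u]
        by (simp add: E_def v_def \<mu>_eq[OF elim(1)])
    qed
    then have 1: "(\<lambda>N. char (\<mu> N) u - E N) \<longlonglongrightarrow> 0"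
      using err by (rule Lim_null_comparison)
    \<comment> \<open>By \<open>vq\<close> the exponent of \<open>E N\<close> is
      \<open>(q N)\<^sup>2 * (1 - p N) / 2\<close>. Its limit is the Gaussian exponent for standard
      deviation \<open>\<beta>\<^sup>2 / 8\<close>.\<close>
    have "(\<lambda>N. complex_of_real (exp (- ((q N)\<^sup>2 * (1 - p N) / 2))))
        \<longlonglongrightarrow> complex_of_real (exp (- ((u * \<beta>\<^sup>2 / 8)\<^sup>2 * (1 - 0) / 2)))"
      by (intro tendsto_intros q p0) auto
    moreover have "\<forall>\<^sub>F N in sequentially. complex_of_real (exp (- ((q N)\<^sup>2 * (1 - p N) / 2))) = E N"
      using ev1
    proof eventually_elim
      case (elim N)
      then show ?case unfolding E_def vq[OF elim, symmetric] by (simp add: mult_ac)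
    qed
    moreover have "char \<nu> u = complex_of_real (exp (- ((u * \<beta>\<^sup>2 / 8)\<^sup>2 * (1 - 0) / 2)))"
      using beta by (simp add: \<nu>_def \<sigma> char_normal_distribution mult_ac)
    ultimately have 2: "E \<longlonglongrightarrow> char \<nu> u" by (simp only: tendsto_cong)
    show ?thesis using tendsto_add[OF 1 2] by simp
  qed

  \<comment> \<open>Nothing is assumed about \<open>M 0\<close>, so Levy's theorem is applied to the shifted sequence.\<close>
  have "weak_conv_m (\<lambda>n. \<mu> (Suc n)) \<nu>"
  proof (rule levy_continuity)
    show "real_distribution (\<mu> (Suc n))" for n
    proof -
      interpret directed_er_ising "M (Suc n)" "Suc n" "p (Suc n)" "\<epsilon> (Suc n)" \<beta>
        by (rule ising) simp
      show ?thesis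
        unfolding \<mu>_eq[of "Suc n", simplified] by (rule real_distribution_distr) measurable
    qed
    show "real_distribution \<nu>"
      unfolding \<nu>_def using beta by (intro real_distribution_normal) simp
    show "(\<lambda>n. char (\<mu> (Suc n)) u) \<longlonglongrightarrow> char \<nu> u" for u
      using char_lim by (rule LIMSEQ_Suc)
  qed
  then have "weak_conv_m \<mu> \<nu>" by (rule weak_conv_m_Suc)
  then show ?thesis unfolding \<mu>_def[abs_def] \<nu>_def a_def by simp
qed

end
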